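(* Let $\theta:\mathbb{N}\to\mathbb{R}\cup\{\infty\}$ satisfy $\theta(1)\ge 2$ and $\theta(n)\ge P^+(n)$ for all $n\ge 2$, and let $\mathcal{B}$, $B(x)$ and $L$ be as in the context. (i) Assume $\theta(n)\le f(n)$ for all $n$, where $f$ is a function such that $n\log f(n)$ is increasing. If $\sum_{n\ge1}\frac{1}{n\log f(n)}$ diverges, then $L=1$ and $B(x)=o(x)$. (ii) Assume $\theta(n)\ge f(n)\ge 2$ for all $n$, $f(n)\gg P^+(n)$, and that for every $t\ge 1$ there exists $r\in\mathbb{N}$ such that $f(2^rn)\ge t f(n)$ for all $n\ge1$. If $\sum_{n\ge1}\frac{1}{n\log f(n)}$ converges, then $L<1$ and $B(x)\sim(1-L)x$. (iii) The following are equivalent: $B(x)\sim x$; $L=0$; $\theta(n)=\infty$ for all $n\ge 1$; $B(x)=[x]$ for all $x$.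
   Context: $P^+(n)$ is the largest prime factor of $n\ge2$ ($P^+(1)=1$). $\mathcal{B}$ is the set of positive integers consisting of $1$ and all $n\ge2$ with factorization $n=p_1^{\alpha_1}\cdots p_k^{\alpha_k}$, $p_1<\cdots<p_k$, such that $p_{j+1}\le\theta(p_1^{\alpha_1}\cdots p_j^{\alpha_j})$ for $0\le j<k$ (empty product $=1$). $\chi$ is its characteristic function, $B(x)=\#\{n\le x:n\in\mathcal{B}\}$, and $L=\sum_{n\ge1}\frac{\chi(n)}{n}\prod_{p\le\theta(n)}(1-1/p)$ (product over all primes if $\theta(n)=\infty$). *)

theory Defs
  imports
    Complex_Main
    "HOL-Library.Extended_Nonnegative_Real"
    "HOL-Library.Landau_Symbols"
    "HOL-Computational_Algebra.Primes"
begin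

definition Pplus :: "nat \<Rightarrow> nat" where
  "Pplus n = (if n \<le> 1 then 1 else Max (prime_factors n))"

text \<open>
  With 0-based indexing, \<open>ps ! j\<close> is the prime $p_{j+1}$ of the factorization
  $n = p_1^{\alpha_1} \cdots p_k^{\alpha_k}$, $p_1 < \cdots < p_k$. For \<open>n = 1\<close> the list is
  empty and the condition is vacuous.
\<close>

definition B_set :: "(nat \<Rightarrow> ereal) \<Rightarrow> nat set" where
  "B_set \<theta> = {n. n \<ge> 1 \<and>
     (let ps = sorted_list_of_set (prime_factors n) in
       \<forall>j<length ps. ereal (real (ps ! j)) \<le> \<theta> (\<Prod>i<j. (ps ! i) ^ multiplicity (ps ! i) n))}"

definition B_count :: "(nat \<Rightarrow> ereal) \<Rightarrow> real \<Rightarrow> nat" where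
  "B_count \<theta> x = card {n \<in> B_set \<theta>. real n \<le> x}"

text \<open>
  The product over all primes is a limit of partial products; \<open>prodinf\<close> is not usable here
  because the product diverges to 0.
\<close>

definition prime_prod :: "ereal \<Rightarrow> real" where
  "prime_prod y =
     (if y = \<infinity> then lim (\<lambda>N::nat. \<Prod>p | prime p \<and> p \<le> N. 1 - 1 / real p)
      else (\<Prod>p | prime (p::nat) \<and> ereal (real p) \<le> y. 1 - 1 / real p))"

text \<open>
  The terms are nonnegative, so summing in \<^typ>\<open>ennreal\<close> gives the value of the series
  without presupposing convergence.
\<close>

definition L_const :: "(nat \<Rightarrow> ereal) \<Rightarrow> ennreal" where
  "L_const \<theta> =
     (\<Sum>n. ennreal (indicator (B_set \<theta>) (Suc n) / real (Suc n) * prime_prod (\<theta> (Suc n))))"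

end

theory Submission
  imports Defs "HOL-Analysis.Analysis" "HOL-Number_Theory.Prime_Powers"
begin

text \<open>
  Every positive integer is uniquely \<open>m = n * r\<close> with \<open>n \<in> B_set \<theta>\<close> and all prime factors of \<open>r\<close>
  exceeding \<open>\<theta> n\<close>, and \<open>m \<in> B_set \<theta>\<close> iff \<open>r = 1\<close>. For fixed \<open>n\<close> the integers \<open>m\<close> with \<open>r > 1\<close> have
  density equal to the \<open>n\<close>-th term of \<open>L\<close>, and an upper bound sieve shows that their number up to \<open>x\<close>
  is at most a constant times \<open>x\<close> times that term, uniformly in \<open>x\<close> and \<open>n\<close>. Dominated convergence
  then gives \<open>B(x) / x \<longlongrightarrow> 1 - L\<close>, so only the value of \<open>L\<close> matters.

  For (i), if \<open>L < 1\<close> then \<open>B_set \<theta>\<close> has positive density, so the divergence of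
  \<open>\<Sum> 1 / (n ln (f n))\<close> persists when restricted to \<open>B_set \<theta>\<close>; by Mertens' lower bound
  \<open>L\<close> would be infinite. For (ii), \<open>2 ^ R * m\<close> fails to lie in \<open>B_set \<theta>\<close> only if \<open>m = n * r\<close> with
  \<open>r > 1\<close> free of primes up to \<open>t * f n\<close>; by the sieve the density of such \<open>m\<close> is
  \<open>O(\<Sum> 1 / (n ln (t * f n)))\<close>, which is small for large \<open>t\<close>. Hence \<open>B_set \<theta>\<close> has positive density
  and \<open>L < 1\<close>.
\<close>

section \<open>Euler products and Chebyshev's bound\<close>

definition smooth_over :: "nat set \<Rightarrow> nat set" where
  "smooth_over P = {n. n \<ge> 1 \<and> prime_factors n \<subseteq> P}"

text \<open>Induction step of the Euler product: splitting off the exact power of \<open>p\<close>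
  turns a sum over \<open>smooth_over (insert p P)\<close> into a geometric series in
  \<open>k\<close> times a sum over \<open>smooth_over P\<close>.\<close>

lemma smooth_over_insert_bij:
  assumes p: "prime p" "p \<notin> P"
  shows "bij_betw (\<lambda>(k, m). p ^ k * m) (UNIV \<times> smooth_over P) (smooth_over (insert p P))"
proof (rule bij_betw_byWitness[where f' = "\<lambda>n. (multiplicity p n, n div p ^ multiplicity p n)"])
  have nd: "\<not> p dvd m" if "m \<in> smooth_over P" for m
    using that p by (auto simp: smooth_over_def prime_factors_dvd)
  have mult: "multiplicity p (p ^ k * m) = k" if m: "m \<in> smooth_over P" for k m
    using nd[OF m] p m by (intro multiplicity_eqI) (auto simp: mult.commute[of _ m] smooth_over_def)
  show "\<forall>a\<in>UNIV \<times> smooth_over P. (multiplicity p (case a of (k, m) \<Rightarrow> p ^ k * m),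
      (case a of (k, m) \<Rightarrow> p ^ k * m) div p ^ multiplicity p (case a of (k, m) \<Rightarrow> p ^ k * m)) = a"
    using p by (auto simp: mult prime_gt_0_nat)
  show "\<forall>n\<in>smooth_over (insert p P). (case (multiplicity p n, n div p ^ multiplicity p n) of
      (k, m) \<Rightarrow> p ^ k * m) = n"
    by (auto simp: multiplicity_dvd)
  show "(\<lambda>(k, m). p ^ k * m) ` (UNIV \<times> smooth_over P) \<subseteq> smooth_over (insert p P)"
  proof clarify
    fix k m assume m: "m \<in> smooth_over P"
    have "q \<in> insert p P" if "q \<in> prime_factors (p ^ k * m)" for q
    proof -
      have q: "prime q" "q dvd p ^ k * m" using that by auto
      hence "q dvd p \<or> q dvd m" using prime_dvd_mult_iff prime_dvd_power by blast
      thus ?thesis using q(1) p m by (auto simp: smooth_over_def primes_dvd_imp_eq prime_factors_dvd)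
    qed
    thus "p ^ k * m \<in> smooth_over (insert p P)"
      using m p by (auto simp: smooth_over_def prime_gt_0_nat Suc_le_eq)
  qed
  show "(\<lambda>n. (multiplicity p n, n div p ^ multiplicity p n)) ` smooth_over (insert p P)
      \<subseteq> UNIV \<times> smooth_over P"
  proof (clarsimp simp: smooth_over_def)
    fix n :: nat assume n: "Suc 0 \<le> n" "prime_factors n \<subseteq> insert p P"
    obtain m where m: "n = p ^ multiplicity p n * m" "\<not> p dvd m"
      by (rule multiplicity_decompose'[of n p]) (use p n in auto)
    have "n div p ^ multiplicity p n = m"
      by (subst m(1)) (use p in \<open>simp add: prime_gt_0_nat\<close>)
    moreover have "prime_factors m \<subseteq> prime_factors n"
      using m n by (metis dvd_prime_factors dvd_triv_right not_one_le_zero One_nat_def)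
    moreover have "p \<notin> prime_factors m" using m by auto
    moreover have "m > 0" using m n by (cases m) auto
    ultimately show "Suc 0 \<le> n div p ^ multiplicity p n \<and>
        prime_factors (n div p ^ multiplicity p n) \<subseteq> P"
      using n by auto
  qed
qed

text \<open>Since \<open>P\<close> is finite, the series converges for every \<open>s > 0\<close>.
  It is used both at \<open>s = 1\<close>, where zeta itself diverges, and at
  \<open>s = 1 + e\<close>.\<close>

lemma euler_product_has_sum:
  fixes s :: real
  assumes "finite P" "\<And>p. p \<in> P \<Longrightarrow> prime p" "s > 0"
  shows "((\<lambda>n. real n powr - s) has_sum (\<Prod>p\<in>P. 1 / (1 - real p powr - s))) (smooth_over P)"
  using assms(1,2)
proof (induction P rule: finite_induct)
  case empty
  have "smooth_over {} = {1}" 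
    by (auto simp: smooth_over_def prime_factorization_empty_iff)
  thus ?case using has_sum_finite[of "{1}" "\<lambda>n. real n powr - s"] by simp
next
  case (insert p P)
  define S where "S = (\<Prod>p\<in>P. 1 / (1 - real p powr - s))"
  have p: "prime p" using insert by simp
  define q where "q = real p powr - s"
  have p1: "real p > 1" using p prime_gt_1_nat by force
  have q: "0 < q" "q < 1" using p1 \<open>s > 0\<close>
    by (auto simp: q_def powr_less_one)
  have IH: "((\<lambda>n. real n powr - s) has_sum S) (smooth_over P)" using insert S_def by simp
  have geo: "((\<lambda>k. q ^ k) has_sum (1 / (1 - q))) UNIV"
    using q by (intro sums_nonneg_imp_has_sum geometric_sums) auto
  have eq: "real (p ^ k * m) powr - s = q ^ k * real m powr - s" for k m
    using p1 by (simp add: powr_mult q_def powr_power powr_realpow[symmetric] powr_powr mult.commute)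
  have inner: "((\<lambda>m. q ^ k * real m powr - s) has_sum (q ^ k * S)) (smooth_over P)" for k
    by (rule has_sum_cmult_right[OF IH])
  have outer: "((\<lambda>k. q ^ k * S) has_sum (1 / (1 - q) * S)) UNIV"
    by (rule has_sum_cmult_left[OF geo])
  have "((\<lambda>(k, m). q ^ k * real m powr - s) has_sum (1 / (1 - q) * S)) (UNIV \<times> smooth_over P)"
  proof (rule has_sum_SigmaI[where g = "\<lambda>k. q ^ k * S"])
    show "(\<lambda>(k, m). q ^ k * real m powr - s) summable_on UNIV \<times> smooth_over P"
      using inner outer q 
      by (intro summable_on_SigmaI[where g = "\<lambda>k. q ^ k * S"]) (auto simp: has_sum_imp_summable)
  qed (use inner outer in auto)
  hence "((\<lambda>a. real (case a of (k, m) \<Rightarrow> p ^ k * m) powr - s) has_sum (1 / (1 - q) * S)) (UNIV \<times> smooth_over P)"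
    by (rule has_sum_cong[THEN iffD1, rotated]) (auto simp: eq simp del: of_nat_mult)
  hence "((\<lambda>n. real n powr - s) has_sum (1 / (1 - q) * S)) (smooth_over (insert p P))"
    using has_sum_reindex_bij_betw[OF smooth_over_insert_bij[OF p \<open>p \<notin> P\<close>], of "\<lambda>n. real n powr - s"]
    by simp
  thus ?case using insert by (simp add: S_def q_def)
qed

text \<open>Integral comparison for zeta in discrete form: the term at n is at most ((n-1)^(-e) -
  n^(-e)) / e, and these differences telescope. The induction step is (1 - 1/n)^(-e) \<ge> 1 +
  e/n.\<close>

lemma sum_powr_le_zeta_bound:
  fixes e :: real
  assumes "e > 0"
  shows "(\<Sum>n=1..Suc N. real n powr - (1 + e)) \<le> 1 + (1 - real (Suc N) powr - e) / e"
proof (induction N)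
  case (Suc N)
  define n where "n = real (Suc (Suc N))"
  have n: "n > 1" "real (Suc N) = n * (1 - 1 / n)" by (auto simp: n_def field_simps)
  have pos: "1 - 1 / n > 0" using n by simp
  have l: "ln (1 - 1 / n) \<le> - 1 / n"
    using ln_add_one_self_le_self2[of "- 1 / n"] n by simp
  have "1 + e / n \<le> exp (e / n)" by (rule exp_ge_add_one_self)
  also have "\<dots> \<le> exp (- e * ln (1 - 1 / n))"
    using mult_left_mono[OF l, of e] assms by simp
  also have "\<dots> = (1 - 1 / n) powr - e" using pos n(1) by (auto simp: powr_def)
  finally have "n powr - e * (1 + e / n) \<le> n powr - e * (1 - 1 / n) powr - e"
    by (intro mult_left_mono) auto
  also have "\<dots> = real (Suc N) powr - e" using n(1) pos unfolding n(2) by (subst powr_mult) auto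
  finally have "e * n powr - (1 + e) \<le> real (Suc N) powr - e - n powr - e"
    using n by (simp add: powr_diff powr_minus field_simps powr_add)
  hence "n powr - (1 + e) \<le> (real (Suc N) powr - e - n powr - e) / e"
    using assms by (simp add: field_simps)
  with Suc show ?case unfolding n_def by (simp add: diff_divide_distrib)
qed simp

lemma euler_product_le:
  fixes e :: real
  assumes P: "finite P" "\<And>p. p \<in> P \<Longrightarrow> prime p" and e: "e > 0"
  shows "(\<Prod>p\<in>P. 1 / (1 - real p powr - (1 + e))) \<le> 1 + 1 / e"
proof (rule has_sum_le_finite_sums)
  show "((\<lambda>n. real n powr - (1 + e)) has_sum (\<Prod>p\<in>P. 1 / (1 - real p powr - (1 + e)))) (smooth_over P)"
    using P e by (intro euler_product_has_sum) auto
  fix F assume F: "finite F" "F \<subseteq> smooth_over P"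
  obtain N where N: "\<forall>n\<in>F. n \<le> N" using F(1) finite_nat_set_iff_bounded_le by blast
  have "(\<Sum>n\<in>F. real n powr - (1 + e)) \<le> (\<Sum>n=1..Suc N. real n powr - (1 + e))"
    using N F by (intro sum_mono2) (force simp: smooth_over_def)+
  also have "\<dots> \<le> 1 + (1 - real (Suc N) powr - e) / e" by (rule sum_powr_le_zeta_bound[OF e])
  also have "\<dots> \<le> 1 + 1 / e" using e by (simp add: divide_right_mono)
  finally show "(\<Sum>n\<in>F. real n powr - (1 + e)) \<le> 1 + 1 / e" .
qed

lemma sum_inverse_le_euler_product:
  assumes "finite P" "\<And>p. p \<in> P \<Longrightarrow> prime p" "finite F" "F \<subseteq> smooth_over P"
  shows "(\<Sum>n\<in>F. 1 / real n) \<le> (\<Prod>p\<in>P. 1 / (1 - 1 / real p))"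
proof -
  have p: "real n powr - 1 = 1 / real n" for n by (simp add: powr_minus inverse_eq_divide)
  have "((\<lambda>n. real n powr - 1) has_sum (\<Prod>p\<in>P. 1 / (1 - real p powr - 1))) (smooth_over P)"
    using assms by (intro euler_product_has_sum) auto
  thus ?thesis unfolding p by (rule finite_sum_le_has_sum) (use assms in auto)
qed

section \<open>Legendre's formula, Chebyshev's upper bound and the upper half of Mertens' first
  theorem\<close>

lemma ln_fact_eq_sum_mangoldt:
  "ln (fact n :: real) = (\<Sum>d=1..n. mangoldt d * real (n div d))"
proof -
  have "ln (fact n :: real) = (\<Sum>k=1..n. ln (real k))"
    by (induction n) (simp_all add: ln_mult)
  also have "\<dots> = (\<Sum>k=1..n. \<Sum>d\<in>{1..n}. if d dvd k then mangoldt d else 0)"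
  proof (rule sum.cong[OF refl])
    fix k assume k: "k \<in> {1..n}"
    have "ln (real k) = (\<Sum>d | d dvd k. mangoldt d)" using mangoldt_sum[of k, where ?'a = real] k by simp
    also have "\<dots> = (\<Sum>d\<in>{1..n} \<inter> {d. d dvd k}. mangoldt d)"
      using k dvd_imp_le[of _ k] by (intro sum.cong) (force simp: Suc_le_eq dvd_pos_nat)+
    also have "\<dots> = (\<Sum>d\<in>{1..n}. if d dvd k then mangoldt d else 0)"
      by (simp add: sum.inter_restrict)
    finally show "ln (real k) = (\<Sum>d\<in>{1..n}. if d dvd k then mangoldt d else 0)" .
  qed
  also have "\<dots> = (\<Sum>d=1..n. \<Sum>k=1..n. if d dvd k then mangoldt d else 0)"
    by (rule sum.swap)
  also have "\<dots> = (\<Sum>d=1..n. mangoldt d * real (n div d))"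
  proof (rule sum.cong[OF refl])
    fix d assume d: "d \<in> {1..n}"
    have "(\<Sum>k=1..n. if d dvd k then mangoldt d else (0::real)) = (\<Sum>k\<in>{k\<in>{1..n}. d dvd k}. mangoldt d)"
      by (rule sum.inter_filter[symmetric]) simp
    also have "\<dots> = mangoldt d * real (card {k\<in>{1..n}. d dvd k})" by simp
    also have "{k\<in>{1..n}. d dvd k} = (\<lambda>i. d * i) ` {1..n div d}"
      using d by (auto simp: less_eq_div_iff_mult_less_eq mult.commute Suc_le_eq elim!: dvdE)
    also have "card \<dots> = n div d" using d by (subst card_image) (auto simp: inj_on_def)
    finally show "(\<Sum>k=1..n. if d dvd k then mangoldt d else (0::real)) = mangoldt d * real (n div d)" .
  qed
  finally show ?thesis .
qed

text \<open>By Legendre's formula, ln (2n choose n) is the sum of \<open>mangoldt d\<close> times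
  floor(2n/d) - 2 floor(n/d). This weight is never negative and equals 1 for n < d \<le> 2n, while
  the binomial coefficient is at most 4^n.\<close>

lemma sum_mangoldt_double:
  "(\<Sum>d=1..2 * n. mangoldt d) - (\<Sum>d=1..n. mangoldt d :: real) \<le> 2 * real n"
proof -
  \<comment> \<open>For d > n the quotient \<open>n div d\<close> is 0, so both factorials can be
    summed over the same range.\<close>
  have ext: "(\<Sum>d=1..n. mangoldt d * real (n div d)) = (\<Sum>d=1..2*n. mangoldt d * real (n div d))"
    by (intro sum.mono_neutral_left) auto
  have "(\<Sum>d=1..2 * n. mangoldt d :: real) = (\<Sum>d=1..n. mangoldt d) + (\<Sum>d=n+1..2*n. mangoldt d)"
    using sum.ub_add_nat[of 1 n mangoldt n] by (simp add: mult_2)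
  hence "(\<Sum>d=1..2 * n. mangoldt d) - (\<Sum>d=1..n. mangoldt d :: real) = (\<Sum>d=n+1..2*n. mangoldt d)" by simp
  also have "\<dots> = (\<Sum>d=n+1..2*n. mangoldt d * (real (2*n div d) - 2 * real (n div d)))"
  proof (rule sum.cong[OF refl])
    fix d assume d: "d \<in> {n+1..2*n}"
    have "2 * n div d = 1" using d by (intro div_nat_eqI) auto
    moreover have "n div d = 0" using d by simp
    ultimately show "mangoldt d = mangoldt d * (real (2*n div d) - 2 * real (n div d))" by simp
  qed
  also have "\<dots> \<le> (\<Sum>d=1..2*n. mangoldt d * (real (2*n div d) - 2 * real (n div d)))"
  proof (rule sum_mono2)
    fix d assume "d \<in> {1..2*n} - {n+1..2*n}"
    have "2 * (n div d) \<le> 2 * n div d"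
      using div_times_less_eq_dividend[of n d]
      by (cases "d = 0") (auto simp: less_eq_div_iff_mult_less_eq)
    hence "2 * real (n div d) \<le> real (2 * n div d)" by linarith
    thus "0 \<le> mangoldt d * (real (2*n div d) - 2 * real (n div d))"
      by (intro mult_nonneg_nonneg mangoldt_nonneg) auto
  qed auto
  also have "\<dots> = ln (fact (2 * n)) - 2 * ln (fact n)"
    unfolding ln_fact_eq_sum_mangoldt ext
    by (simp add: algebra_simps sum_subtractf sum_distrib_left)
  also have "\<dots> = ln (real ((2 * n) choose n))"
    using binomial_fact[of n "2 * n", where ?'a = real]
    by (simp add: ln_div ln_mult)
  also have "\<dots> \<le> ln (2 ^ (2 * n))"
    using binomial_le_pow2[of "2 * n" n] 
    by (subst ln_le_cancel_iff) (auto simp: of_nat_le_iff[symmetric] simp del: of_nat_le_iff)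
  also have "\<dots> = 2 * real n * ln 2" by (simp add: ln_realpow)
  also have "\<dots> \<le> 2 * real n" using ln_2_less_1 by (intro mult_left_le) auto
  finally show ?thesis .
qed

text \<open>Halving: with k = n div 2, the doubling bound and the bound 4k give 6k for the sum up to
  2k. The slack up to 8k absorbs the extra term that appears when n is odd.\<close>

lemma chebyshev_sum_mangoldt_le: "(\<Sum>d=1..n. mangoldt d :: real) \<le> 4 * real n"
proof (induction n rule: less_induct)
  case (less n)
  show ?case
  proof (cases "n \<le> 1")
    case True thus ?thesis by (auto simp: le_Suc_eq)
  next
    case False
    define k where "k = n div 2"
    have k: "k < n" using False by (simp add: k_def)
    have "(\<Sum>d=1..k. mangoldt d :: real) \<le> 4 * real k" using less k by simp
    with sum_mangoldt_double[of k] have 2: "(\<Sum>d=1..2*k. mangoldt d :: real) \<le> 6 * real k" by simp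
    show ?thesis
    proof (cases "even n")
      case True thus ?thesis using 2 by (simp add: k_def)
    next
      case False
      hence n: "n = Suc (2 * k)" by (simp add: k_def)
      have "mangoldt n \<le> ln (real n)" using n by (intro mangoldt_le) simp
      also have "\<dots> \<le> 2 * real k" using ln_add_one_self_le_self[of "2 * real k"] n by simp
      finally show ?thesis using 2 n by simp
    qed
  qed
qed

text \<open>Only the prime terms of Legendre's formula are kept, and ln z! \<le> z ln z. The factor
  2 pays for replacing z/p by its integer part, which is at least 1 since p \<le> z.\<close>

lemma sum_ln_prime_div_le:
  assumes "z \<ge> 1"
  shows "(\<Sum>p | prime p \<and> p \<le> z. ln (real p) / real p) \<le> 2 * ln (real z)"
proof -
  have "real z * (\<Sum>p | prime p \<and> p \<le> z. ln (real p) / real p)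
      \<le> (\<Sum>p | prime p \<and> p \<le> z. 2 * (mangoldt p * real (z div p)))"
    unfolding sum_distrib_left
  proof (rule sum_mono)
    fix p assume p: "p \<in> {p. prime p \<and> p \<le> z}"
    hence p1: "p \<ge> 1" "prime p" using prime_ge_1_nat by auto
    have "z < p * Suc (z div p)" using p1 by (simp add: dividend_less_times_div)
    moreover have "z div p \<ge> 1" using p p1 by (simp add: Suc_le_eq div_greater_zero_iff)
    hence "p * Suc (z div p) \<le> p * (2 * (z div p))" by (intro mult_left_mono) auto
    ultimately have "z \<le> p * (2 * (z div p))" by linarith
    hence "real z \<le> real p * (2 * real (z div p))" by (metis of_nat_le_iff of_nat_mult of_nat_numeral)
    hence "real z / real p \<le> 2 * real (z div p)" using p1 by (simp add: field_simps)
    hence "ln (real p) * (real z / real p) \<le> ln (real p) * (2 * real (z div p))"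
      using p1 by (intro mult_left_mono) auto
    thus "real z * (ln (real p) / real p) \<le> 2 * (mangoldt p * real (z div p))"
      using p1 by (simp add: mult_ac)
  qed
  also have "\<dots> \<le> (\<Sum>d=1..z. 2 * (mangoldt d * real (z div d)))"
    by (intro sum_mono2) (auto simp: mangoldt_nonneg Suc_le_eq prime_gt_0_nat)
  also have "\<dots> = 2 * ln (fact z)"
    by (simp add: ln_fact_eq_sum_mangoldt sum_distrib_left)
  also have "\<dots> \<le> 2 * ln (real (z ^ z))"
    using assms fact_le_power[of z, where ?'a = real] by (subst mult_le_cancel_left_pos) (auto simp: of_nat_power)
  also have "\<dots> = real z * (2 * ln (real z))" using assms by (simp add: ln_realpow)
  finally show ?thesis using assms by simp
qed

section \<open>The product over primes and rough numbers\<close>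

lemma finite_primes_le: "y \<noteq> \<infinity> \<Longrightarrow> finite {p::nat. prime p \<and> ereal (real p) \<le> y}"
proof (rule finite_subset)
  assume "y \<noteq> \<infinity>"
  thus "{p::nat. prime p \<and> ereal (real p) \<le> y} \<subseteq> {..nat \<lfloor>real_of_ereal y\<rfloor>}"
    by (cases y) (auto simp: le_nat_floor)
qed auto

lemma prime_prod_of_nat:
  "prime_prod (ereal (real z)) = (\<Prod>p | prime p \<and> p \<le> z. 1 - 1 / real p)"
  by (simp add: prime_prod_def)

lemma prime_prod_floor:
  assumes "y \<ge> 0"
  shows "prime_prod (ereal y) = prime_prod (ereal (real (nat \<lfloor>y\<rfloor>)))"
proof -
  have "{p. prime p \<and> real p \<le> y} = {p. prime p \<and> p \<le> nat \<lfloor>y\<rfloor>}"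
    using assms by (auto simp: le_nat_floor le_nat_iff le_floor_iff)
  thus ?thesis by (simp add: prime_prod_def)
qed

lemma prime_prod_pos: "y \<noteq> \<infinity> \<Longrightarrow> prime_prod y > 0"
  by (auto simp: prime_prod_def intro!: prod_pos) (metis divide_less_eq_1 of_nat_1 of_nat_less_iff
      of_nat_0_less_iff prime_gt_0_nat prime_gt_1_nat)

lemma prime_prod_antimono:
  assumes "y \<le> z" "z \<noteq> \<infinity>"
  shows "prime_prod z \<le> prime_prod y"
proof -
  have y: "y \<noteq> \<infinity>" using assms by auto
  define A where "A = {p::nat. prime p \<and> ereal (real p) \<le> y}"
  define B where "B = {p::nat. prime p \<and> ereal (real p) \<le> z}"
  have le1: "1 / real p \<le> 1" if "prime p" for p using prime_ge_1_nat[OF that] by simp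
  have AB: "A \<subseteq> B" "finite B"
    using assms finite_primes_le[of z] by (auto simp: A_def B_def intro: order.trans)
  have "(\<Prod>p\<in>B. 1 - 1 / real p) = (\<Prod>p\<in>B - A. 1 - 1 / real p) * (\<Prod>p\<in>A. 1 - 1 / real p)"
    using AB by (intro prod.subset_diff)
  also have "\<dots> \<le> 1 * (\<Prod>p\<in>A. 1 - 1 / real p)"
    using le1 by (intro mult_right_mono prod_le_1 prod_nonneg) (auto simp: A_def B_def)
  finally have "(\<Prod>p\<in>B. 1 - 1 / real p) \<le> (\<Prod>p\<in>A. 1 - 1 / real p)" by simp
  thus ?thesis using assms y by (simp add: prime_prod_def A_def B_def)
qed

text \<open>Every integer up to \<open>z\<close> is composed of primes up to \<open>z\<close>, so
  the Euler product dominates the harmonic sum. The argument \<open>z + 1\<close> of the logarithm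
  later makes up for rounding a real y down to \<open>z\<close>.\<close>

lemma inverse_prod_primes_ge_ln:
  "ln (real z + 1) \<le> (\<Prod>p | prime p \<and> p \<le> z. 1 / (1 - 1 / real p))"
proof -
  have "ln (real z + 1) \<le> harm z" by (rule ln_le_harm)
  also have "\<dots> = (\<Sum>n=1..z. 1 / real n)" by (simp add: harm_def inverse_eq_divide)
  also have "\<dots> \<le> (\<Prod>p | prime p \<and> p \<le> z. 1 / (1 - 1 / real p))"
  proof (rule sum_inverse_le_euler_product)
    have "p \<le> z" if "p \<in> prime_factors n" "Suc 0 \<le> n" "n \<le> z" for p n
      using that by (meson dual_order.trans dvd_imp_le in_prime_factors_imp_dvd less_eq_Suc_le)
    thus "{1..z} \<subseteq> smooth_over {p. prime p \<and> p \<le> z}"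
      by (auto simp: smooth_over_def)
  qed auto
  finally show ?thesis .
qed

lemma prime_prod_le_inverse_ln:
  assumes "y > 1"
  shows "prime_prod (ereal y) \<le> 1 / ln y"
proof -
  define z where "z = nat \<lfloor>y\<rfloor>"
  have "y \<le> real z + 1" using assms unfolding z_def by linarith
  hence "ln y \<le> ln (real z + 1)" using assms by simp
  also have "\<dots> \<le> 1 / prime_prod (ereal (real z))"
    using inverse_prod_primes_ge_ln[of z] by (simp add: prime_prod_of_nat prod_dividef)
  also have "prime_prod (ereal (real z)) = prime_prod (ereal y)"
    using prime_prod_floor[of y] assms by (simp add: z_def)
  finally have "ln y \<le> 1 / prime_prod (ereal y)" .
  thus ?thesis using assms prime_prod_pos[of "ereal y"] by (simp add: field_simps)
qed

text \<open>The limit in the definition is squeezed between 0 and 1 / ln N, so an infinite value of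
  \<open>\<theta>\<close> contributes nothing to L.\<close>

lemma prime_prod_infinity: "prime_prod \<infinity> = 0"
proof -
  have "(\<lambda>N::nat. \<Prod>p | prime p \<and> p \<le> N. 1 - 1 / real p) \<longlonglongrightarrow> 0"
  proof (rule tendsto_sandwich)
    show "\<forall>\<^sub>F N in sequentially. 0 \<le> (\<Prod>p | prime p \<and> p \<le> N. 1 - 1 / real p)"
      using prime_prod_pos by (auto simp: prime_prod_of_nat[symmetric] intro!: always_eventually less_imp_le)
    show "\<forall>\<^sub>F N in sequentially. (\<Prod>p | prime p \<and> p \<le> N. 1 - 1 / real p) \<le> 1 / ln (real N)"
      using eventually_gt_at_top[of 1]
      by eventually_elim (simp add: prime_prod_of_nat[symmetric] prime_prod_le_inverse_ln)
    show "(\<lambda>N. 1 / ln (real N)) \<longlonglongrightarrow> 0" 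
      by (intro tendsto_divide_0[OF tendsto_const] filterlim_at_top_imp_at_infinity
          filterlim_compose[OF ln_at_top] filterlim_real_sequentially)
  qed auto
  thus ?thesis by (simp add: prime_prod_def limI)
qed

lemma prime_prod_nonneg: "prime_prod y \<ge> 0"
  using prime_prod_pos[of y] prime_prod_infinity by (cases "y = \<infinity>") auto

text \<open>Replacing the exponent \<open>1\<close> by \<open>1 + e\<close> with \<open>e = 1 / ln z\<close> changes the product over the primes up
  to \<open>z\<close> by a bounded factor only, and the new product is bounded below by
  \<open>1 / \<zeta>(1 + e) \<ge> 1 / (1 + ln z)\<close>.\<close>

lemma prime_prod_of_nat_ge:
  assumes z: "z \<ge> 2"
  shows "prime_prod (ereal (real z)) \<ge> 1 / (3 * exp 4 * ln (real z))"
proof -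
  let ?P = "{p. prime p \<and> p \<le> z}"
  define e where "e = 1 / ln (real z)"
  have lnz: "ln (real z) > 0" using z by simp
  have e: "e > 0" using lnz by (simp add: e_def)
  \<comment> \<open>With a = 1/p and u = e ln p, convexity gives p^(-e) \<ge> 1 - u. The resulting
    error a u is at most 2 (1 - a) a u because p \<ge> 2, and so it fits into the factor exp(2 a
    u).\<close>
  have step: "1 - real p powr - (1 + e) \<le> (1 - 1 / real p) * exp (2 * e * (ln (real p) / real p))"
    if "p \<in> ?P" for p
  proof -
    define a where "a = 1 / real p"
    have p: "real p \<ge> 2" using that prime_ge_2_nat by auto
    have a: "0 < a" "a \<le> 1 / 2" using p by (auto simp: a_def field_simps)
    define u where "u = e * ln (real p)"
    have u: "u \<ge> 0" using e p by (simp add: u_def)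
    have "1 - u \<le> real p powr - e" using exp_ge_add_one_self[of "- u"] p by (simp add: powr_def u_def)
    hence "a * (1 - u) \<le> a * real p powr - e" using a by (intro mult_left_mono) auto
    also have "\<dots> = real p powr - (1 + e)"
      using p by (simp add: a_def powr_add powr_minus field_simps powr_diff)
    finally have "1 - real p powr - (1 + e) \<le> 1 - a + a * u" by (simp add: algebra_simps)
    also have "\<dots> \<le> (1 - a) * (1 + 2 * a * u)"
    proof -
      have "a * u \<le> (1 - a) * 2 * (a * u)" using a u mult_right_mono[of 1 "(1 - a) * 2" "a * u"] by simp
      thus ?thesis by (simp add: algebra_simps)
    qed
    also have "\<dots> \<le> (1 - a) * exp (2 * a * u)"
      using a by (intro mult_left_mono exp_ge_add_one_self) auto
    finally show ?thesis by (simp add: a_def u_def mult_ac)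
  qed
  have pos: "0 < 1 - real p powr - (1 + e)" if "p \<in> ?P" for p
    using that e prime_gt_1_nat[of p] by (simp add: powr_less_one)
  have "(\<Prod>p\<in>?P. 1 - real p powr - (1 + e))
      \<le> (\<Prod>p\<in>?P. (1 - 1 / real p) * exp (2 * e * (ln (real p) / real p)))"
    using pos step by (intro prod_mono) (auto intro: less_imp_le)
  also have "\<dots> = prime_prod (ereal (real z)) * exp (2 * e * (\<Sum>p\<in>?P. ln (real p) / real p))"
    by (simp add: prod.distrib prime_prod_of_nat exp_sum sum_distrib_left)
  \<comment> \<open>By the Mertens estimate the exponent is at most 4 e ln z, which the choice of
    \<open>e\<close> makes equal to 4.\<close>
  also have "\<dots> \<le> prime_prod (ereal (real z)) * exp (2 * e * (2 * ln (real z)))"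
    using sum_ln_prime_div_le[of z] z e prime_prod_nonneg
    by (intro mult_left_mono) auto
  also have "2 * e * (2 * ln (real z)) = 4" using lnz by (simp add: e_def)
  finally have 1: "(\<Prod>p\<in>?P. 1 - real p powr - (1 + e)) \<le> prime_prod (ereal (real z)) * exp 4" .
  define Q where "Q = (\<Prod>p\<in>?P. 1 - real p powr - (1 + e))"
  have Q: "Q > 0" unfolding Q_def using pos by (intro prod_pos) auto
  have "1 / Q = (\<Prod>p\<in>?P. 1 / (1 - real p powr - (1 + e)))" by (simp add: prod_dividef Q_def)
  also have "\<dots> \<le> 1 + 1 / e" by (rule euler_product_le) (use e in auto)
  also have "\<dots> = 1 + ln (real z)" by (simp add: e_def)
  \<comment> \<open>Since ln z \<ge> ln 2 \<ge> 1/2, the summand 1 is at most 2 ln z.\<close>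
  also have "\<dots> \<le> 3 * ln (real z)"
  proof -
    have "1 / 2 \<le> ln (2::real)" using ln2_ge_two_thirds by simp
    also have "\<dots> \<le> ln (real z)" using z by simp
    finally show ?thesis by simp
  qed
  finally have "1 \<le> 3 * ln (real z) * Q" using Q by (simp add: field_simps)
  also have "\<dots> \<le> 3 * ln (real z) * (prime_prod (ereal (real z)) * exp 4)"
    using 1 lnz unfolding Q_def[symmetric] by (intro mult_left_mono) auto
  finally show ?thesis using lnz by (simp add: field_simps)
qed

lemma prime_prod_ge:
  assumes y: "y \<ge> 2"
  shows "prime_prod (ereal y) \<ge> 1 / (3 * exp 4 * ln y)"
proof -
  define z where "z = nat \<lfloor>y\<rfloor>"
  have z: "z \<ge> 2" "real z \<le> y" using y by (auto simp: z_def le_nat_iff le_floor_iff)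
  have "1 / (3 * exp 4 * ln y) \<le> 1 / (3 * exp 4 * ln (real z))"
    using y z by (intro divide_left_mono mult_left_mono mult_pos_pos) auto
  also have "\<dots> \<le> prime_prod (ereal (real z))" by (rule prime_prod_of_nat_ge[OF z(1)])
  also have "\<dots> = prime_prod (ereal y)" using prime_prod_floor[of y] y by (simp add: z_def)
  finally show ?thesis .
qed

section \<open>Sieve estimates for integers without small prime factors\<close>

definition rough :: "ereal \<Rightarrow> nat \<Rightarrow> bool" where
  "rough y r \<longleftrightarrow> (\<forall>p. prime p \<longrightarrow> p dvd r \<longrightarrow> y < ereal (real p))"

text \<open>The value r = 1 is left out: in the decomposition m = n * r it is the case where m
  itself lies in \<open>B_set \<theta>\<close>.\<close>

definition rough_count :: "real \<Rightarrow> ereal \<Rightarrow> nat" where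
  "rough_count x y = card {r. 2 \<le> r \<and> real r \<le> x \<and> rough y r}"

lemma rough_dvd: "rough y r \<Longrightarrow> m dvd r \<Longrightarrow> rough y m"
  unfolding rough_def using dvd_trans by blast

lemma finite_nat_real_le: "finite {r::nat. P r \<and> real r \<le> x}"
  by (rule finite_subset[of _ "{..nat \<lfloor>x\<rfloor>}"]) (auto simp: le_nat_floor)

lemma rough_count_eq_0:
  assumes "ereal x \<le> y"
  shows "rough_count x y = 0"
proof -
  have "\<not> rough y r" if r: "2 \<le> r" "real r \<le> x" for r
  proof -
    obtain p where p: "prime p" "p dvd r" using prime_factor_nat[of r] r by auto
    have "ereal (real p) \<le> ereal x" using dvd_imp_le[OF p(2)] r by simp
    thus ?thesis using p assms unfolding rough_def by (meson leD order.trans)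
  qed
  hence "{r. 2 \<le> r \<and> real r \<le> x \<and> rough y r} = {}" by auto
  thus ?thesis unfolding rough_count_def by (metis card.empty)
qed

text \<open>Weighting a rough integer \<open>r\<close> by \<open>ln r = \<Sum>d | d dvd r. mangoldt d\<close> and exchanging the order
  of summation gains the factor \<open>ln z\<close> over the trivial bound.\<close>

lemma rough_card_ln_le:
  fixes y :: ereal
  assumes z: "z \<ge> 1"
  defines "G \<equiv> {r\<in>{1..z}. rough y r}"
  shows "real (card G) * ln (real z) \<le> 5 * real z * (\<Sum>m\<in>G. 1 / real m)"
proof -
  have "(\<Sum>r\<in>G. ln (real r)) = (\<Sum>r\<in>G. \<Sum>d | d dvd r. mangoldt d)"
    using mangoldt_sum[where ?'a = real] by (intro sum.cong) (auto simp: G_def)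
  also have "\<dots> = (\<Sum>(r, d)\<in>Sigma G (\<lambda>r. {d. d dvd r}). mangoldt d)"
    by (rule sum.Sigma) (auto simp: G_def)
  \<comment> \<open>Write r = m * d. The cofactor m inherits roughness from r, whereas the condition
    on d is dropped; this is why only an inequality results.\<close>
  also have "\<dots> \<le> (\<Sum>(m, d)\<in>Sigma G (\<lambda>m. {1..z div m}). mangoldt d)"
  proof (rule sum_le_included[where i = "\<lambda>(m, d). (m * d, d)"])
    show "finite (Sigma G (\<lambda>r. {d. d dvd r}))" by (auto simp: G_def)
    show "finite (Sigma G (\<lambda>m. {1..z div m}))" by (auto simp: G_def)
    show "\<forall>x\<in>Sigma G (\<lambda>r. {d. d dvd r}). \<exists>y\<in>Sigma G (\<lambda>m. {1..z div m}).
        (case y of (m, d) \<Rightarrow> (m * d, d)) = x \<and>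
        (case x of (r, d) \<Rightarrow> (mangoldt d :: real)) \<le> (case y of (m, d) \<Rightarrow> mangoldt d)"
    proof clarify
      fix r d assume r: "r \<in> G" and "d dvd r"
      then obtain m where m: "r = m * d" by (metis dvdE mult.commute)
      have md: "m > 0" "d > 0" "m * d \<le> z" "rough y m"
        using r m rough_dvd by (auto simp: G_def)
      have "m \<le> m * d" using md by simp
      hence "m \<le> z" using md(3) by linarith
      hence "m \<in> G" using md by (auto simp: G_def)
      moreover have "d \<in> {1..z div m}"
        using md by (auto simp: less_eq_div_iff_mult_less_eq mult.commute)
      ultimately show "\<exists>y\<in>Sigma G (\<lambda>m. {1..z div m}).
        (case y of (m, d) \<Rightarrow> (m * d, d)) = (r, d) \<and>
        (mangoldt d :: real) \<le> (case y of (m, d) \<Rightarrow> mangoldt d)"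
        using m by (intro bexI[of _ "(m, d)"]) auto
    qed
  qed (auto simp: mangoldt_nonneg)
  also have "\<dots> = (\<Sum>m\<in>G. \<Sum>d=1..z div m. mangoldt d)"
    by (rule sum.Sigma[symmetric]) (auto simp: G_def)
  also have "\<dots> \<le> (\<Sum>m\<in>G. 4 * (real z * (1 / real m)))"
  proof (rule sum_mono)
    fix m assume "m \<in> G"
    have "(\<Sum>d=1..z div m. mangoldt d :: real) \<le> 4 * real (z div m)" by (rule chebyshev_sum_mangoldt_le)
    also have "\<dots> \<le> 4 * (real z * (1 / real m))" using of_nat_div_le_of_nat[of z m, where ?'a = real] by simp
    finally show "(\<Sum>d=1..z div m. mangoldt d :: real) \<le> 4 * (real z * (1 / real m))" .
  qed
  finally have 1: "(\<Sum>r\<in>G. ln (real r)) \<le> 4 * real z * (\<Sum>m\<in>G. 1 / real m)"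
    by (simp add: sum_distrib_left mult_ac)
  \<comment> \<open>Passing from the weight ln r to ln z costs at most z/r for each r. Together with
    the 4 from Chebyshev's bound this makes the constant 5.\<close>
  have "(\<Sum>r\<in>G. ln (real z) - ln (real r)) \<le> (\<Sum>r\<in>G. real z * (1 / real r))"
  proof (rule sum_mono)
    fix r assume "r \<in> G"
    hence r: "r > 0" by (auto simp: G_def)
    have "ln (real z) - ln (real r) = ln (real z / real r)" using r z by (simp add: ln_div)
    also have "\<dots> \<le> real z / real r" using r z by (intro ln_bound) auto
    finally show "ln (real z) - ln (real r) \<le> real z * (1 / real r)" by simp
  qed
  hence "real (card G) * ln (real z) - (\<Sum>r\<in>G. ln (real r)) \<le> real z * (\<Sum>m\<in>G. 1 / real m)"
    by (simp add: sum_subtractf sum_distrib_left)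
  with 1 show ?thesis by (simp add: algebra_simps)
qed

text \<open>The integers summed have all their prime factors in (y, z], and the Euler product over
  these primes is the quotient of the two prime products.\<close>

lemma sum_inverse_rough_le:
  assumes y: "y \<le> ereal (real z)"
  shows "(\<Sum>m | m \<in> {1..z} \<and> rough y m. 1 / real m) \<le> prime_prod y / prime_prod (ereal (real z))"
proof -
  define P where "P = {p. prime p \<and> y < ereal (real p) \<and> p \<le> z}"
  define A where "A = {p. prime p \<and> ereal (real p) \<le> y}"
  have y': "y \<noteq> \<infinity>" using y by auto
  have fin: "finite A" "finite P" using finite_primes_le[OF y'] by (auto simp: A_def P_def)
  have "(\<Sum>m | m \<in> {1..z} \<and> rough y m. 1 / real m) \<le> (\<Prod>p\<in>P. 1 / (1 - 1 / real p))"
  proof (rule sum_inverse_le_euler_product)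
    have "p \<in> P" if "p \<in> prime_factors n" "rough y n" "Suc 0 \<le> n" "n \<le> z" for p n
      using that dvd_imp_le[of p n] by (auto simp: P_def rough_def)
    thus "{m. m \<in> {1..z} \<and> rough y m} \<subseteq> smooth_over P"
      by (auto simp: smooth_over_def)
  qed (use fin in \<open>auto simp: P_def\<close>)
  also have "\<dots> = 1 / (\<Prod>p\<in>P. 1 - 1 / real p)" by (simp add: prod_dividef)
  also have "prime_prod (ereal (real z)) = (\<Prod>p\<in>A \<union> P. 1 - 1 / real p)"
  proof -
    have "real p \<le> real z" if "ereal (real p) \<le> y" for p using order.trans[OF that y] by simp
    hence "{p. prime p \<and> p \<le> z} = A \<union> P" by (auto simp: A_def P_def)
    thus ?thesis by (simp add: prime_prod_of_nat)
  qed
  hence "prime_prod (ereal (real z)) = prime_prod y * (\<Prod>p\<in>P. 1 - 1 / real p)"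
    using fin y' by (subst (asm) prod.union_disjoint) (auto simp: A_def P_def prime_prod_def)
  hence "1 / (\<Prod>p\<in>P. 1 - 1 / real p) = prime_prod y / prime_prod (ereal (real z))"
    using prime_prod_pos[OF y'] by simp
  finally show ?thesis .
qed

text \<open>Upper bound sieve, uniform in x and y. The previous two lemmas bound the count times ln
  z by 5 z times a quotient of prime products; Mertens' lower bound for the denominator produces a
  factor 3 exp(4) ln z, and ln z cancels. Uniformity is what allows domination later.\<close>

lemma rough_count_le:
  assumes x: "x \<ge> 0"
  shows "real (rough_count x y) \<le> 15 * exp 4 * x * prime_prod y"
proof -
  define z where "z = nat \<lfloor>x\<rfloor>"
  have zx: "real z \<le> x" using x by (simp add: z_def)
  have le: "real r \<le> x \<longleftrightarrow> r \<le> z" for r using x by (auto simp: z_def le_nat_iff le_floor_iff)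
  have eq: "rough_count x y = rough_count (real z) y" by (simp add: rough_count_def le)
  have nonneg: "0 \<le> 15 * exp 4 * x * prime_prod y" using x prime_prod_nonneg by simp
  show ?thesis
  proof (cases "z \<ge> 2 \<and> y < ereal (real z)")
    \<comment> \<open>For z < 2 no r \<ge> 2 is available, and for y \<ge> z every prime factor of r
      is at most y. The count is 0 in both cases.\<close>
    case False
    hence "rough_count (real z) y = 0"
      using rough_count_eq_0[of "real z" y] by (auto simp: rough_count_def)
    thus ?thesis using eq nonneg by simp
  next
    case True
    define G where "G = {r\<in>{1..z}. rough y r}"
    have lnz: "ln (real z) > 0" using True by simp
    have V: "1 \<le> prime_prod (ereal (real z)) * (3 * exp 4 * ln (real z))"
      using prime_prod_of_nat_ge[of z] True lnz by (simp add: field_simps)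
    have "rough_count x y \<le> card G"
      unfolding rough_count_def by (rule card_mono) (auto simp: G_def le)
    hence "real (rough_count x y) * ln (real z) \<le> real (card G) * ln (real z)"
      using lnz by (intro mult_right_mono) auto
    also have "\<dots> \<le> 5 * real z * (\<Sum>m\<in>G. 1 / real m)"
      unfolding G_def using True by (intro rough_card_ln_le) auto
    also have "\<dots> \<le> 5 * real z * (prime_prod y / prime_prod (ereal (real z)))"
      unfolding G_def using sum_inverse_rough_le[of y z] True by (intro mult_left_mono) auto
    also have "\<dots> \<le> 5 * real z * (prime_prod y * (3 * exp 4 * ln (real z)))"
      using mult_left_mono[OF V prime_prod_nonneg[of y]] prime_prod_pos[of "ereal (real z)"]
      by (intro mult_left_mono) (auto simp: field_simps)
    also have "\<dots> = 15 * exp 4 * real z * prime_prod y * ln (real z)" by simp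
    also have "\<dots> \<le> 15 * exp 4 * x * prime_prod y * ln (real z)"
      using zx lnz prime_prod_nonneg by (intro mult_right_mono mult_left_mono) auto
    finally show ?thesis using lnz by simp
  qed
qed

text \<open>Legendre's sieve: sifting by one more prime p subtracts the old count at x/p from the
  old count at x, so the error at most doubles.\<close>

lemma card_not_dvd_primes_error:
  assumes "finite P" "\<And>p. p \<in> P \<Longrightarrow> prime p" "x \<ge> 0"
  shows "\<bar>real (card {r. 1 \<le> r \<and> real r \<le> x \<and> (\<forall>p\<in>P. \<not> p dvd r)}) - x * (\<Prod>p\<in>P. 1 - 1 / real p)\<bar>
      \<le> 2 ^ card P"
  using assms
proof (induction P arbitrary: x rule: finite_induct)
  case empty
  have "{r. 1 \<le> r \<and> real r \<le> x} = {1..nat \<lfloor>x\<rfloor>}"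
    using empty by (auto simp: le_nat_iff le_floor_iff)
  hence "card {r. 1 \<le> r \<and> real r \<le> x} = nat \<lfloor>x\<rfloor>" by simp
  thus ?case using empty by (simp add: abs_le_iff) linarith
next
  case (insert p P)
  define A where "A = (\<lambda>x. {r. 1 \<le> r \<and> real r \<le> x \<and> (\<forall>p\<in>P. \<not> p dvd r)})"
  define V where "V = (\<Prod>p\<in>P. 1 - 1 / real p)"
  have p: "prime p" using insert by simp
  have fin: "finite (A x)" for x 
    unfolding A_def by (rule finite_subset[OF _ finite_nat_real_le[of "\<lambda>_. True" x]]) auto
  have IH: "\<bar>real (card (A x)) - x * V\<bar> \<le> 2 ^ card P" if "x \<ge> 0" for x
    using insert that by (simp add: A_def V_def)
  have mult: "{r\<in>A x. p dvd r} = (\<lambda>m. p * m) ` A (x / real p)"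
  proof -
    have "q dvd p * m \<longleftrightarrow> q dvd m" if "q \<in> P" for q m
    proof -
      have "prime q" "q \<noteq> p" using that insert by auto
      thus ?thesis using p by (metis prime_dvd_mult_iff primes_dvd_imp_eq)
    qed
    hence "p * m \<in> A x \<longleftrightarrow> m \<in> A (x / real p)" for m
      using prime_gt_0_nat[OF p] by (auto simp: A_def field_simps)
    thus ?thesis by (auto elim!: dvdE)
  qed
  have "{r. 1 \<le> r \<and> real r \<le> x \<and> (\<forall>q\<in>insert p P. \<not> q dvd r)} = A x - {r\<in>A x. p dvd r}"
    by (auto simp: A_def)
  also have "card \<dots> = card (A x) - card {r\<in>A x. p dvd r}"
    by (intro card_Diff_subset) (auto simp: fin)
  also have "card {r\<in>A x. p dvd r} = card (A (x / real p))"
    unfolding mult using prime_gt_0_nat[OF p] by (intro card_image) (auto simp: inj_on_def)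
  finally have "card {r. 1 \<le> r \<and> real r \<le> x \<and> (\<forall>q\<in>insert p P. \<not> q dvd r)}
      = card (A x) - card (A (x / real p))" .
  moreover have "card (A (x / real p)) \<le> card (A x)"
    using card_mono[OF fin[of x], of "{r\<in>A x. p dvd r}"] \<open>card {r\<in>A x. p dvd r} = card (A (x / real p))\<close> by auto
  ultimately have eq: "real (card {r. 1 \<le> r \<and> real r \<le> x \<and> (\<forall>q\<in>insert p P. \<not> q dvd r)})
      = real (card (A x)) - real (card (A (x / real p)))" by simp
  have V': "x * (\<Prod>q\<in>insert p P. 1 - 1 / real q) = x * V - x / real p * V"
    using insert by (simp add: V_def algebra_simps)
  have abs_diff: "\<bar>a - b - (c - d)\<bar> \<le> 2 * k" if "\<bar>a - c\<bar> \<le> k" "\<bar>b - d\<bar> \<le> k" for a b c d k :: real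
    using that by linarith
  have "2 ^ card (insert p P) = 2 * (2::real) ^ card P" using insert by simp
  thus ?case unfolding eq V' using abs_diff[OF IH[of x] IH[of "x / real p"]] insert by simp
qed

text \<open>Here \<open>K\<close> may depend on y, which suffices for the pointwise limits of
  dominated convergence. Legendre's sieve also counts r = 1, hence the extra 1 in the bound.\<close>

lemma rough_count_error:
  "\<exists>K. \<forall>x\<ge>0. \<bar>real (rough_count x y) - x * prime_prod y\<bar> \<le> K"
proof (cases "y = \<infinity>")
  case True
  thus ?thesis using rough_count_eq_0[of _ y] prime_prod_infinity by auto
next
  case False
  define P where "P = {p::nat. prime p \<and> ereal (real p) \<le> y}"
  have "\<bar>real (rough_count x y) - x * prime_prod y\<bar> \<le> 2 ^ card P + 1" if "x \<ge> 0" for x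
  proof -
    define A where "A = {r. 1 \<le> r \<and> real r \<le> x \<and> (\<forall>p\<in>P. \<not> p dvd r)}"
    have V: "prime_prod y = (\<Prod>p\<in>P. 1 - 1 / real p)" using False by (simp add: prime_prod_def P_def)
    have A: "\<bar>real (card A) - x * prime_prod y\<bar> \<le> 2 ^ card P"
      unfolding A_def V using that finite_primes_le[OF False]
      by (intro card_not_dvd_primes_error) (auto simp: P_def)
    have rough: "rough y r \<longleftrightarrow> (\<forall>p\<in>P. \<not> p dvd r)" for r
      unfolding rough_def P_def using leD leI by blast
    have "{r. 2 \<le> r \<and> real r \<le> x \<and> rough y r} = A - {1}"
      using rough by (auto simp: A_def)
    hence "rough_count x y = card (A - {1})" by (simp add: rough_count_def)
    hence "card A \<le> rough_count x y + 1" "rough_count x y \<le> card A"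
      by (auto simp: card_Diff_singleton_if)
    thus ?thesis using A by linarith
  qed
  thus ?thesis by blast
qed

lemma rough_count_div_tendsto:
  assumes n: "n > 0"
  shows "((\<lambda>x. real (rough_count (x / real n) y) / x) \<longlongrightarrow> prime_prod y / real n) at_top"
proof -
  obtain K where K: "\<And>x. x \<ge> 0 \<Longrightarrow> \<bar>real (rough_count x y) - x * prime_prod y\<bar> \<le> K"
    using rough_count_error[of y] by blast
  have "((\<lambda>x. real (rough_count (x / real n) y) / x - prime_prod y / real n) \<longlongrightarrow> 0) at_top"
  proof (rule Lim_null_comparison)
    show "((\<lambda>x::real. K / x) \<longlongrightarrow> 0) at_top" 
      by (intro tendsto_divide_0[OF tendsto_const] filterlim_at_top_imp_at_infinity filterlim_ident)
    show "\<forall>\<^sub>F x in at_top. norm (real (rough_count (x / real n) y) / x - prime_prod y / real n) \<le> K / x"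
      using eventually_gt_at_top[of 0]
    proof eventually_elim
      case (elim x)
      have "real (rough_count (x / real n) y) / x - prime_prod y / real n
          = (real (rough_count (x / real n) y) - x / real n * prime_prod y) / x"
        using elim by (simp add: diff_divide_distrib)
      thus ?case using K[of "x / real n"] elim by (simp add: divide_right_mono)
    qed
  qed
  thus ?thesis by (simp add: LIM_zero_iff)
qed

section \<open>Unique decomposition\<close>

text \<open>For the prime p = p_{j+1} of n this is the product p_1^{\<alpha>_1} ...
  p_j^{\<alpha>_j}. Indexing by the prime rather than by its position allows initial parts of
  different integers to be compared.\<close>

definition initial_part :: "nat \<Rightarrow> nat \<Rightarrow> nat" where
  "initial_part p n = (\<Prod>q | q \<in> prime_factors n \<and> q < p. q ^ multiplicity q n)"

text \<open>Since the list is strictly increasing, the entries before position j are exactly the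
  prime factors below \<open>ps ! j\<close>.\<close>

lemma B_set_iff:
  "n \<in> B_set \<theta> \<longleftrightarrow> n \<ge> 1 \<and> (\<forall>p\<in>prime_factors n. ereal (real p) \<le> \<theta> (initial_part p n))"
proof -
  define ps where "ps = sorted_list_of_set (prime_factors n)"
  have set: "set ps = prime_factors n" and sorted: "sorted_wrt (<) ps" and dist: "distinct ps"
    by (auto simp: ps_def)
  have "(\<Prod>i<j. (ps ! i) ^ multiplicity (ps ! i) n) = initial_part (ps ! j) n" if j: "j < length ps" for j
  proof -
    have less: "ps ! i < ps ! k \<longleftrightarrow> i < k" if "i < length ps" "k < length ps" for i k
      using sorted_wrt_nth_less[OF sorted] that by (metis less_asym' linorder_neqE_nat)
    have "{q. q \<in> set ps \<and> q < ps ! j} = (\<lambda>i. ps ! i) ` {..<j}"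
      using j less by (auto simp: in_set_conv_nth image_iff dest: less_trans)
    hence "{q. q \<in> prime_factors n \<and> q < ps ! j} = (\<lambda>i. ps ! i) ` {..<j}"
      unfolding set .
    moreover have "inj_on (\<lambda>i. ps ! i) {..<j}"
      using j dist by (auto simp: inj_on_def nth_eq_iff_index_eq)
    ultimately show ?thesis unfolding initial_part_def by (simp add: prod.reindex)
  qed
  hence "(\<forall>j<length ps. ereal (real (ps ! j)) \<le> \<theta> (\<Prod>i<j. (ps ! i) ^ multiplicity (ps ! i) n))
      \<longleftrightarrow> (\<forall>p\<in>set ps. ereal (real p) \<le> \<theta> (initial_part p n))"
    by (simp add: all_set_conv_all_nth)
  thus ?thesis unfolding set by (simp add: B_set_def Let_def ps_def)
qed

lemma initial_part_mult:
  assumes "n \<ge> 1" "r \<ge> 1" "\<And>q. q \<in> prime_factors r \<Longrightarrow> p \<le> q"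
  shows "initial_part p (n * r) = initial_part p n"
  unfolding initial_part_def
proof (rule prod.cong)
  show "{q. q \<in> prime_factors (n * r) \<and> q < p} = {q. q \<in> prime_factors n \<and> q < p}"
    using assms by (auto simp: prime_factors_product dest: leD)
  fix q assume q: "q \<in> {q. q \<in> prime_factors n \<and> q < p}"
  have "\<not> q dvd r" using q assms by (auto simp: prime_factors_dvd dest!: leD)
  thus "q ^ multiplicity q (n * r) = q ^ multiplicity q n"
    using q assms by (subst prime_elem_multiplicity_mult_distrib) (auto simp: not_dvd_imp_multiplicity_0)
qed

lemma initial_part_eq_self:
  assumes "n \<ge> 1" "\<And>q. q \<in> prime_factors n \<Longrightarrow> q < p"
  shows "initial_part p n = n"
proof -
  have "{q. q \<in> prime_factors n \<and> q < p} = prime_factors n" using assms by auto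
  thus ?thesis using prime_factorization_nat[of n] assms by (simp add: initial_part_def)
qed

lemma initial_part_decompose:
  assumes m: "m \<ge> 1"
  obtains r where "m = initial_part p m * r" "initial_part p m \<ge> 1" "r \<ge> 1"
    "\<And>q. q \<in> prime_factors (initial_part p m) \<Longrightarrow> q < p" "\<And>q. q \<in> prime_factors r \<Longrightarrow> p \<le> q"
proof -
  let ?A = "{q. q \<in> prime_factors m \<and> q < p}" and ?B = "{q. q \<in> prime_factors m \<and> \<not> q < p}"
  define r where "r = (\<Prod>q\<in>?B. q ^ multiplicity q m)"
  have "prime_factors m = ?A \<union> ?B" by auto
  hence "m = (\<Prod>q\<in>?A \<union> ?B. q ^ multiplicity q m)"
    using prime_factorization_nat[of m] m by simp
  also have "\<dots> = initial_part p m * r"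
    unfolding r_def initial_part_def by (rule prod.union_disjoint) auto
  finally have eq: "m = initial_part p m * r" .
  have dvd: "q \<in> S" if S: "prime q" "q dvd (\<Prod>q\<in>S. q ^ multiplicity q m)" "finite S" "S \<subseteq> prime_factors m" for q S
  proof -
    obtain s where s: "s \<in> S" "q dvd s ^ multiplicity s m" using S by (auto simp: prime_dvd_prod_iff)
    hence "q dvd s" using that prime_dvd_power by blast
    moreover have "prime s" using s that by auto
    ultimately show ?thesis using primes_dvd_imp_eq[OF \<open>prime q\<close>] s by auto
  qed
  have pos: "initial_part p m \<ge> 1 \<and> r \<ge> 1" 
  proof -
    have "initial_part p m * r > 0" using eq m by linarith
    thus ?thesis by (auto simp: Suc_le_eq)
  qed
  show ?thesis
  proof (rule that[OF eq])
    fix q assume "q \<in> prime_factors (initial_part p m)"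
    hence "q \<in> ?A" unfolding initial_part_def by (intro dvd) auto
    thus "q < p" by simp
  next
    fix q assume "q \<in> prime_factors r"
    hence "q \<in> ?B" unfolding r_def by (intro dvd) auto
    thus "p \<le> q" by simp
  qed (use pos in auto)
qed

text \<open>Let p be the least prime factor of m that violates the defining condition, and n the
  part of m below p. Smaller primes satisfy the condition with unchanged initial parts, so n lies in
  the set. The primes of r are at least p > \<open>\<theta> n\<close>, and p divides r.\<close>

lemma B_set_decompose:
  assumes m: "m \<ge> 1" "m \<notin> B_set \<theta>"
  obtains n r where "m = n * r" "n \<in> B_set \<theta>" "r \<ge> 2" "rough (\<theta> n) r"
proof -
  define bad where "bad = (\<lambda>p. p \<in> prime_factors m \<and> \<not> ereal (real p) \<le> \<theta> (initial_part p m))"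
  define p where "p = (LEAST p. bad p)"
  have "\<exists>p. bad p" using m by (auto simp: B_set_iff bad_def)
  hence p: "bad p" unfolding p_def by (metis LeastI)
  have least: "\<not> bad q" if "q < p" for q using not_less_Least that unfolding p_def by blast
  define n where "n = initial_part p m"
  obtain r where r: "m = n * r" "n \<ge> 1" "r \<ge> 1" "\<And>q. q \<in> prime_factors n \<Longrightarrow> q < p"
      "\<And>q. q \<in> prime_factors r \<Longrightarrow> p \<le> q"
    using initial_part_decompose[OF m(1), of p] unfolding n_def by metis
  have pf: "prime_factors m = prime_factors n \<union> prime_factors r"
    using r by (simp add: prime_factors_product)
  show ?thesis
  proof (rule that)
    show "m = n * r" by fact
    show "n \<in> B_set \<theta>" unfolding B_set_iff
    proof (intro conjI ballI)
      fix q assume q: "q \<in> prime_factors n"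
      have "initial_part q m = initial_part q n"
        using r r(4)[OF q] by (auto intro!: initial_part_mult dest!: r(5))
      thus "ereal (real q) \<le> \<theta> (initial_part q n)"
        using least[OF r(4)[OF q]] q pf by (auto simp: bad_def)
    qed fact
    have "p \<in> prime_factors r" using p r(4)[of p] pf by (auto simp: bad_def)
    thus "r \<ge> 2" using r(3) by (cases "r = 1") auto
    show "rough (\<theta> n) r" unfolding rough_def
    proof (intro allI impI)
      fix q assume "prime q" "q dvd r"
      hence "p \<le> q" using r by (auto simp: prime_factors_dvd)
      moreover have "\<theta> n < ereal (real p)" using p by (auto simp: bad_def n_def)
      ultimately show "\<theta> n < ereal (real q)" by (meson ereal_less_eq(3) less_le_trans of_nat_le_iff)
    qed
  qed
qed

lemma nat_floor_div_tendsto: "((\<lambda>x::real. real (nat \<lfloor>x\<rfloor>) / x) \<longlongrightarrow> 1) at_top"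
proof (rule tendsto_sandwich[of "\<lambda>x. 1 - 1 / x" _ _ "\<lambda>_. 1"])
  show "\<forall>\<^sub>F x::real in at_top. 1 - 1 / x \<le> real (nat \<lfloor>x\<rfloor>) / x"
    using eventually_gt_at_top[of 0]
  proof eventually_elim
    case (elim x)
    have "x - 1 \<le> real (nat \<lfloor>x\<rfloor>)" using elim by linarith
    hence "(x - 1) / x \<le> real (nat \<lfloor>x\<rfloor>) / x" using elim by (intro divide_right_mono) auto
    thus ?case using elim by (simp add: diff_divide_distrib)
  qed
  show "\<forall>\<^sub>F x::real in at_top. real (nat \<lfloor>x\<rfloor>) / x \<le> 1"
    using eventually_gt_at_top[of 0] by eventually_elim (simp add: divide_le_eq)
  have "((\<lambda>x::real. 1 - 1 / x) \<longlongrightarrow> 1 - 0) at_top"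
    by (intro tendsto_diff tendsto_const tendsto_divide_0[OF tendsto_const]
        filterlim_at_top_imp_at_infinity filterlim_ident)
  thus "((\<lambda>x::real. 1 - 1 / x) \<longlongrightarrow> 1) at_top" by simp
qed auto

section \<open>Uniqueness of the decomposition and the resulting count\<close>

locale prime_bound =
  fixes \<theta> :: "nat \<Rightarrow> ereal"
  assumes theta_1: "\<theta> 1 \<ge> 2"
    and theta_ge: "\<And>n. n \<ge> 2 \<Longrightarrow> \<theta> n \<ge> ereal (real (Pplus n))"
begin

lemma prime_factor_le_theta:
  assumes "q \<in> prime_factors n"
  shows "ereal (real q) \<le> \<theta> n"
proof -
  have n: "n \<ge> 2" using assms by (cases "n = 0 \<or> n = 1") auto
  have "q \<le> Pplus n" using assms n by (simp add: Pplus_def)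
  hence "ereal (real q) \<le> ereal (real (Pplus n))" by simp
  also have "\<dots> \<le> \<theta> n" by (rule theta_ge[OF n])
  finally show ?thesis .
qed

lemma theta_ge_2:
  assumes "n \<ge> 1"
  shows "\<theta> n \<ge> 2"
proof (cases "n = 1")
  case False
  then obtain q where q: "prime q" "q dvd n" using prime_factor_nat by blast
  have "(2::ereal) = ereal 2" by simp
  also have "\<dots> \<le> ereal (real q)" using prime_ge_2_nat[OF q(1)] by (subst ereal_less_eq) simp
  also have "\<dots> \<le> \<theta> n" using q assms by (intro prime_factor_le_theta) (auto simp: prime_factors_dvd)
  finally show ?thesis .
qed (use theta_1 in simp)

text \<open>No prime of n' exceeds \<open>\<theta> n\<close>: for the least such prime p, the common
  product has initial part n below p, and membership of n' forces p \<le> \<open>\<theta> n\<close>.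
  Then n is coprime to r' and n' to r, so n and n' divide each other.\<close>

lemma B_set_decompose_unique_aux:
  assumes n: "n \<in> B_set \<theta>" "n' \<in> B_set \<theta>" and r: "r \<ge> 1" "r' \<ge> 1" "n * r = n' * r'"
    and rough: "rough (\<theta> n) r" "rough (\<theta> n') r'" and le: "\<theta> n \<le> \<theta> n'"
  shows "n = n'"
proof -
  have pos: "n \<ge> 1" "n' \<ge> 1" using n by (auto simp: B_set_iff)
  have rn: "\<theta> n < ereal (real q)" if "q \<in> prime_factors r" for q using that rough by (auto simp: rough_def)
  have rn': "\<theta> n' < ereal (real q)" if "q \<in> prime_factors r'" for q using that rough by (auto simp: rough_def)
  have pf: "prime_factors n \<union> prime_factors r = prime_factors n' \<union> prime_factors r'"
    using r pos by (simp flip: prime_factors_product)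
  have all: "ereal (real q) \<le> \<theta> n" if "q \<in> prime_factors n'" for q
  proof (rule ccontr)
    assume "\<not> ereal (real q) \<le> \<theta> n"
    hence ex: "\<exists>q. q \<in> prime_factors n' \<and> \<theta> n < ereal (real q)" using that by auto
    define p where "p = (LEAST q. q \<in> prime_factors n' \<and> \<theta> n < ereal (real q))"
    have p: "p \<in> prime_factors n'" "\<theta> n < ereal (real p)" using LeastI_ex[OF ex] by (auto simp: p_def)
    have least: "p \<le> q" if "q \<in> prime_factors n'" "\<theta> n < ereal (real q)" for q
      unfolding p_def using that by (intro Least_le) auto
    have p': "ereal (real p) \<le> \<theta> n'" using p by (intro prime_factor_le_theta)
    have r'_ge: "p \<le> q" if "q \<in> prime_factors r'" for q
      using le_less_trans[OF p' rn'[OF that]] by simp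
    \<comment> \<open>A prime of r exceeds \<open>\<theta> n\<close> and divides n' or r'. In the
      first case minimality of p applies, in the second p \<le> \<open>\<theta> n'\<close> <
      q.\<close>
    have r_ge: "p \<le> q" if "q \<in> prime_factors r" for q
      using that pf least rn[OF that] r'_ge by blast
    have n_less: "q < p" if "q \<in> prime_factors n" for q
      using le_less_trans[OF prime_factor_le_theta[OF that] p(2)] by simp
    have "initial_part p n' = initial_part p (n' * r')"
      using pos r r'_ge by (intro initial_part_mult[symmetric]) auto
    also have "\<dots> = initial_part p n"
      unfolding r(3)[symmetric] using pos r r_ge by (intro initial_part_mult) auto
    also have "\<dots> = n" using pos n_less by (intro initial_part_eq_self)
    finally have "ereal (real p) \<le> \<theta> n" using n(2) p(1) by (auto simp: B_set_iff)
    thus False using p(2) by simp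
  qed
  have coprime: "coprime a b" if "\<And>q. q \<in> prime_factors a \<Longrightarrow> q \<notin> prime_factors b" "a \<ge> 1" "b \<ge> 1" for a b :: nat
  proof (rule ccontr)
    assume "\<not> coprime a b"
    hence "gcd a b \<noteq> 1" by (simp add: coprime_iff_gcd_eq_1)
    then obtain q where "prime q" "q dvd a" "q dvd b" using prime_factor_nat[of "gcd a b"] by auto
    thus False using that by (auto simp: prime_factors_dvd)
  qed
  have "coprime n r'" using prime_factor_le_theta[of _ n] rn' le pos r
    by (intro coprime) (meson leD order.trans)+
  moreover have "coprime n' r" using all rn pos r
    by (intro coprime) (meson leD)+
  ultimately have "n dvd n'" "n' dvd n"
    using r(3) by (metis coprime_dvd_mult_left_iff dvd_triv_left)+
  thus ?thesis by (rule dvd_antisym)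
qed

lemma B_set_decompose_unique:
  assumes "n \<in> B_set \<theta>" "n' \<in> B_set \<theta>" "r \<ge> 1" "r' \<ge> 1" "n * r = n' * r'"
    "rough (\<theta> n) r" "rough (\<theta> n') r'"
  shows "n = n'"
  using B_set_decompose_unique_aux[OF assms] B_set_decompose_unique_aux[OF assms(2,1,4,3) assms(5)[symmetric] assms(7,6)]
  by (metis linear)

lemma rough_1: "rough y 1"
  by (auto simp: rough_def)

text \<open>The integers up to x are partitioned by their decompositions. Any larger
  \<open>N\<close> is allowed because n > x contributes nothing; this lets partial sums of arbitrary
  length be compared with the exact count.\<close>

lemma nat_floor_eq_B_count:
  assumes x: "x \<ge> 0" and N: "nat \<lfloor>x\<rfloor> \<le> N"
  shows "nat \<lfloor>x\<rfloor> = B_count \<theta> x + (\<Sum>n\<in>B_set \<theta> \<inter> {1..N}. rough_count (x / real n) (\<theta> n))"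
proof -
  have le: "real r \<le> x \<longleftrightarrow> r \<le> nat \<lfloor>x\<rfloor>" for r using x by (auto simp: le_nat_iff le_floor_iff)
  define R where "R = (\<lambda>n. {r. 2 \<le> r \<and> real r \<le> x / real n \<and> rough (\<theta> n) r})"
  define I where "I = B_set \<theta> \<inter> {1..N}"
  define B where "B = {n \<in> B_set \<theta>. real n \<le> x}"
  have finR: "finite (R n)" for n
    unfolding R_def by (rule finite_subset[OF _ finite_nat_real_le[of "\<lambda>_. True" "x / real n"]]) auto
  have finB: "finite B" unfolding B_def by (rule finite_nat_real_le)
  have I: "n \<ge> 1" "n \<in> B_set \<theta>" if "n \<in> I" for n using that by (auto simp: I_def)
  have split: "{1..nat \<lfloor>x\<rfloor>} = B \<union> (\<Union>n\<in>I. (\<lambda>r. n * r) ` R n)"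
  proof (intro equalityI subsetI)
    fix m assume "m \<in> {1..nat \<lfloor>x\<rfloor>}"
    hence m: "m \<ge> 1" "real m \<le> x" by (auto simp: le)
    show "m \<in> B \<union> (\<Union>n\<in>I. (\<lambda>r. n * r) ` R n)"
    proof (cases "m \<in> B_set \<theta>")
      case False
      then obtain n r where nr: "m = n * r" "n \<in> B_set \<theta>" "r \<ge> 2" "rough (\<theta> n) r"
        using B_set_decompose[OF m(1)] by blast
      have n: "n \<ge> 1" using nr by (simp add: B_set_iff)
      have "n \<le> m" using nr by simp
      moreover have "m \<le> nat \<lfloor>x\<rfloor>" using m(2) by (simp add: le)
      ultimately have "n \<le> N" using N by linarith
      hence "n \<in> I" using n nr by (auto simp: I_def)
      moreover have "r \<in> R n" using nr m n by (simp add: R_def field_simps)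
      ultimately show ?thesis using nr by blast
    qed (use m in \<open>auto simp: B_def\<close>)
  next
    fix m assume "m \<in> B \<union> (\<Union>n\<in>I. (\<lambda>r. n * r) ` R n)"
    thus "m \<in> {1..nat \<lfloor>x\<rfloor>}"
    proof
      assume "m \<in> B" thus ?thesis by (auto simp: B_def B_set_iff le)
    next
      assume "m \<in> (\<Union>n\<in>I. (\<lambda>r. n * r) ` R n)"
      then obtain n r where "n \<in> I" "r \<in> R n" "m = n * r" by blast
      moreover from this have "real m \<le> x" using I[of n] by (simp add: R_def field_simps)
      ultimately show ?thesis using I[of n] unfolding le by (auto simp: R_def)
    qed
  qed
  have disj: "B \<inter> (\<Union>n\<in>I. (\<lambda>r. n * r) ` R n) = {}"
  proof (rule ccontr)
    assume "B \<inter> (\<Union>n\<in>I. (\<lambda>r. n * r) ` R n) \<noteq> {}"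
    then obtain n r where nr: "n \<in> I" "r \<in> R n" "n * r \<in> B" by blast
    \<comment> \<open>An element of the set also has the decomposition with cofactor 1, so
      uniqueness rules out a second one with r \<ge> 2.\<close>
    have "n = n * r"
      using nr I[of n] rough_1 by (intro B_set_decompose_unique[of n "n * r" r 1]) (auto simp: R_def B_def)
    thus False using nr I[of n] by (auto simp: R_def)
  qed
  have "nat \<lfloor>x\<rfloor> = card {1..nat \<lfloor>x\<rfloor>}" by simp
  also have "\<dots> = card B + card (\<Union>n\<in>I. (\<lambda>r. n * r) ` R n)"
    unfolding split using finB finR disj by (intro card_Un_disjoint) (auto simp: I_def)
  also have "card (\<Union>n\<in>I. (\<lambda>r. n * r) ` R n) = (\<Sum>n\<in>I. card ((\<lambda>r. n * r) ` R n))"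
  proof (rule card_UN_disjoint)
    show "\<forall>i\<in>I. \<forall>j\<in>I. i \<noteq> j \<longrightarrow> (\<lambda>r. i * r) ` R i \<inter> (\<lambda>r. j * r) ` R j = {}"
    proof (intro ballI impI, rule ccontr)
      fix i j assume ij: "i \<in> I" "j \<in> I" "i \<noteq> j" "(\<lambda>r. i * r) ` R i \<inter> (\<lambda>r. j * r) ` R j \<noteq> {}"
      then obtain r s where "r \<in> R i" "s \<in> R j" "i * r = j * s" by blast
      hence "i = j" using I ij
        by (intro B_set_decompose_unique[of i j r s]) (auto simp: R_def)
      thus False using ij by simp
    qed
  qed (use finR in \<open>auto simp: I_def\<close>)
  also have "\<dots> = (\<Sum>n\<in>I. rough_count (x / real n) (\<theta> n))"
  proof (rule sum.cong[OF refl])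
    fix n assume "n \<in> I"
    hence "card ((\<lambda>r. n * r) ` R n) = card (R n)" using I[of n] by (intro card_image) (auto simp: inj_on_def)
    thus "card ((\<lambda>r. n * r) ` R n) = rough_count (x / real n) (\<theta> n)" by (simp add: R_def rough_count_def)
  qed
  finally show ?thesis by (simp add: I_def B_def B_count_def)
qed

section \<open>The density of the set\<close>

definition L_term :: "nat \<Rightarrow> real" where
  "L_term k = indicator (B_set \<theta>) (Suc k) / real (Suc k) * prime_prod (\<theta> (Suc k))"

text \<open>The proportion, relative to x, of integers whose decomposition has first factor
  \<open>Suc k\<close> and a nontrivial cofactor.\<close>

definition part_density :: "nat \<Rightarrow> real \<Rightarrow> real" where
  "part_density k x = indicator (B_set \<theta>) (Suc k) * (real (rough_count (x / real (Suc k)) (\<theta> (Suc k))) / x)"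

lemma L_term_nonneg: "L_term k \<ge> 0"
  by (simp add: L_term_def prime_prod_nonneg)

lemma part_density_nonneg: "x \<ge> 0 \<Longrightarrow> part_density k x \<ge> 0"
  by (simp add: part_density_def)

lemma part_density_tendsto: "(part_density k \<longlongrightarrow> L_term k) at_top"
proof -
  have "(part_density k \<longlongrightarrow> indicator (B_set \<theta>) (Suc k) * (prime_prod (\<theta> (Suc k)) / real (Suc k))) at_top"
    unfolding part_density_def by (intro tendsto_mult_left rough_count_div_tendsto) simp
  thus ?thesis by (simp add: L_term_def)
qed

lemma part_density_le:
  assumes "x > 0"
  shows "part_density k x \<le> 15 * exp 4 * L_term k"
proof -
  have "real (rough_count (x / real (Suc k)) (\<theta> (Suc k))) / x
      \<le> 15 * exp 4 * (x / real (Suc k)) * prime_prod (\<theta> (Suc k)) / x"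
    using assms by (intro divide_right_mono rough_count_le) auto
  also have "\<dots> = 15 * exp 4 * (prime_prod (\<theta> (Suc k)) / real (Suc k))" using assms by simp
  finally have "indicator (B_set \<theta>) (Suc k) * (real (rough_count (x / real (Suc k)) (\<theta> (Suc k))) / x) \<le>
      indicator (B_set \<theta>) (Suc k) * (15 * exp 4 * (prime_prod (\<theta> (Suc k)) / real (Suc k)))"
    by (rule mult_left_mono) simp
  thus ?thesis by (simp add: part_density_def L_term_def mult_ac)
qed

lemma sum_part_density:
  assumes x: "x > 0" and N: "nat \<lfloor>x\<rfloor> \<le> N"
  shows "(\<Sum>k<N. part_density k x) = (real (nat \<lfloor>x\<rfloor>) - real (B_count \<theta> x)) / x"
proof -
  have "(\<Sum>k<N. part_density k x)
      = (\<Sum>n=1..N. indicator (B_set \<theta>) n * (real (rough_count (x / real n) (\<theta> n)) / x))"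
    unfolding part_density_def by (simp add: sum.atLeast1_atMost_eq)
  also have "\<dots> = (\<Sum>n\<in>B_set \<theta> \<inter> {1..N}. real (rough_count (x / real n) (\<theta> n)) / x)"
    by (rule sum.mono_neutral_cong_right) (auto simp: indicator_def)
  also have "\<dots> = real (\<Sum>n\<in>B_set \<theta> \<inter> {1..N}. rough_count (x / real n) (\<theta> n)) / x"
    by (simp add: sum_divide_distrib)
  finally show ?thesis using nat_floor_eq_B_count[OF less_imp_le[OF x] N] by simp
qed

text \<open>A partial sum is the limit of the proportion of integers lying in finitely many disjoint
  classes. This yields summability of \<open>L_term\<close>, which dominated convergence needs for
  its majorant.\<close>

lemma sum_L_term_le_1: "(\<Sum>k<N. L_term k) \<le> 1"
proof (rule tendsto_upperbound)
  show "((\<lambda>x. \<Sum>k<N. part_density k x) \<longlongrightarrow> (\<Sum>k<N. L_term k)) at_top"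
    by (intro tendsto_sum part_density_tendsto)
  show "\<forall>\<^sub>F x in at_top. (\<Sum>k<N. part_density k x) \<le> 1"
    using eventually_gt_at_top[of 0]
  proof eventually_elim
    case (elim x)
    have "(\<Sum>k<N. part_density k x) \<le> (\<Sum>k<max N (nat \<lfloor>x\<rfloor>). part_density k x)"
      using elim by (intro sum_mono2) (auto simp: part_density_nonneg)
    also have "\<dots> = (real (nat \<lfloor>x\<rfloor>) - real (B_count \<theta> x)) / x"
      using elim by (intro sum_part_density) auto
    also have "\<dots> \<le> x / x" using elim by (intro divide_right_mono) (auto, linarith)
    finally show ?case using elim by simp
  qed
qed simp

lemma summable_L_term: "summable L_term"
  by (rule summableI_nonneg_bounded[OF L_term_nonneg sum_L_term_le_1])

definition L :: real where "L = (\<Sum>k. L_term k)"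

lemma L_const_eq: "L_const \<theta> = ennreal L"
  unfolding L_const_def L_def L_term_def[symmetric]
  by (rule suminf_ennreal2[OF L_term_nonneg summable_L_term])

lemma L_bounds: "0 \<le> L" "L \<le> 1"
  unfolding L_def using L_term_nonneg sum_L_term_le_1
  by (auto intro!: suminf_nonneg suminf_le_const summable_L_term)

lemma B_count_div_tendsto: "((\<lambda>x. real (B_count \<theta> x) / x) \<longlongrightarrow> 1 - L) at_top"
proof -
  have "((\<lambda>x. \<Sum>k. part_density k x) \<longlongrightarrow> L) at_top"
    unfolding L_def
  \<comment> \<open>Tannery's theorem interchanges limit and sum; the majorant is the uniform sieve
    bound \<open>part_density_le\<close>.\<close>
  proof (rule conjunct2[OF conjunct2[OF tannerys_theorem]])
    show "summable (\<lambda>k. 15 * exp 4 * L_term k)" by (intro summable_mult summable_L_term)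
    show "\<forall>\<^sub>F (k, x) in sequentially \<times>\<^sub>F at_top. norm (part_density k x) \<le> 15 * exp 4 * L_term k"
      unfolding eventually_prod_filter
      by (intro exI[of _ "\<lambda>_. True"] exI[of _ "\<lambda>x. x > 0"])
        (auto simp: eventually_gt_at_top part_density_le part_density_nonneg)
  qed (use part_density_tendsto in auto)
  moreover note nat_floor_div_tendsto
  ultimately have "((\<lambda>x. real (nat \<lfloor>x\<rfloor>) / x - (\<Sum>k. part_density k x)) \<longlongrightarrow> 1 - L) at_top"
    by (intro tendsto_diff)
  moreover have "\<forall>\<^sub>F x in at_top. real (nat \<lfloor>x\<rfloor>) / x - (\<Sum>k. part_density k x) = real (B_count \<theta> x) / x"
    using eventually_gt_at_top[of 0]
  proof eventually_elim
    case (elim x)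
    \<comment> \<open>Here x / (k+1) \<le> 1 leaves no room for r \<ge> 2, so the infinite series is
      the finite sum of the exact count.\<close>
    have "part_density k x = 0" if "k \<notin> {..<nat \<lfloor>x\<rfloor>}" for k
    proof -
      have "x \<le> real (Suc k)" using that elim by simp linarith
      hence "x / real (Suc k) \<le> 1" by (simp add: divide_le_eq)
      hence "\<not> real r \<le> x / real (Suc k)" if "r \<ge> 2" for r using that by linarith
      hence "rough_count (x / real (Suc k)) (\<theta> (Suc k)) = 0" unfolding rough_count_def by (metis (no_types, lifting) Collect_empty_eq card.empty)
      thus ?thesis by (simp add: part_density_def)
    qed
    hence "(\<Sum>k. part_density k x) = (\<Sum>k<nat \<lfloor>x\<rfloor>. part_density k x)"
      by (intro suminf_finite) auto
    also have "\<dots> = (real (nat \<lfloor>x\<rfloor>) - real (B_count \<theta> x)) / x"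
      using elim by (intro sum_part_density) auto
    finally show ?case by (simp add: diff_divide_distrib)
  qed
  ultimately show ?thesis by (rule Lim_transform_eventually)
qed

end

section \<open>Divergence and convergence criteria\<close>

text \<open>Contrapositively, a divergent series with decreasing terms still diverges on a set of
  positive lower density. \<open>D\<close> is the surplus of S over its guaranteed share; summation
  by parts shows that the terms on S control \<delta> times all terms, up to a constant.\<close>

lemma summable_if_bounded_on_dense:
  fixes a :: "nat \<Rightarrow> real"
  assumes nonneg: "\<And>n. n \<ge> 1 \<Longrightarrow> a n \<ge> 0"
    and antimono: "\<And>n. n \<ge> 1 \<Longrightarrow> a (Suc n) \<le> a n"
    and dense: "\<delta> > 0" "N0 \<ge> 1" "\<And>N. N \<ge> N0 \<Longrightarrow> \<delta> * real N \<le> real (card (S \<inter> {1..N}))"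
    and bound: "\<And>N. (\<Sum>n=1..N. indicator S n * a n) \<le> C"
  shows "summable (\<lambda>k. a (Suc k))"
proof -
  define D where "D = (\<lambda>N. real (card (S \<inter> {1..N})) - \<delta> * real N)"
  define T where "T = (\<lambda>N. \<Sum>n=1..N. (indicator S n - \<delta>) * a n)"
  have D_Suc: "D (Suc N) = D N + (indicator S (Suc N) - \<delta>)" for N
  proof -
    have "S \<inter> {1..Suc N} = (if Suc N \<in> S then insert (Suc N) (S \<inter> {1..N}) else S \<inter> {1..N})"
      by (auto simp: le_Suc_eq)
    thus ?thesis by (simp add: D_def algebra_simps)
  qed
  \<comment> \<open>Abel summation, started at \<open>N0\<close>, from where on \<open>D\<close> is nonnegative.\<close>
  have T_ge: "T N \<ge> D N * a N - (D N0 * a N0 - T N0)" if "N \<ge> N0" for N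
    using that
  proof (induction N rule: dec_induct)
    case (step N)
    have "0 \<le> D N * (a N - a (Suc N))"
      using dense(3)[OF step(1)] antimono[of N] step(1) dense(2)
      by (intro mult_nonneg_nonneg) (auto simp: D_def)
    moreover have "T (Suc N) = T N + (D (Suc N) - D N) * a (Suc N)"
      by (simp add: T_def D_Suc)
    ultimately show ?case using step.IH by (simp add: algebra_simps)
  qed simp
  define K where "K = (C + (D N0 * a N0 - T N0)) / \<delta>"
  have K: "(\<Sum>n=1..N. a n) \<le> K" if N: "N \<ge> N0" for N
  proof -
    have "0 \<le> D N * a N"
      using dense(2) dense(3)[OF N] N nonneg[of N] by (intro mult_nonneg_nonneg) (auto simp: D_def)
    moreover have "T N = (\<Sum>n=1..N. indicator S n * a n) - \<delta> * (\<Sum>n=1..N. a n)"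
      by (simp add: T_def left_diff_distrib sum_subtractf sum_distrib_left)
    ultimately have "\<delta> * (\<Sum>n=1..N. a n) \<le> C + (D N0 * a N0 - T N0)"
      using T_ge[OF N] bound[of N] by linarith
    thus ?thesis using dense(1) by (simp add: K_def field_simps)
  qed
  show ?thesis
  proof (rule summableI_nonneg_bounded)
    fix N
    have "(\<Sum>k<N. a (Suc k)) = (\<Sum>n=1..N. a n)" by (simp add: sum.atLeast1_atMost_eq)
    also have "\<dots> \<le> (\<Sum>n=1..max N N0. a n)" using nonneg by (intro sum_mono2) auto
    also have "\<dots> \<le> K" by (rule K) simp
    finally show "(\<Sum>k<N. a (Suc k)) \<le> K" .
  qed (use nonneg in auto)
qed

section \<open>The value of L in the three parts of the theorem\<close>

context prime_bound
begin

text \<open>The values of \<open>\<theta>\<close> are constrained only on the set itself, because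
  vanishing terms of L give information only there. No r \<ge> 2 is rough for an infinite bound, so
  nothing can lie outside the set.\<close>

lemma all_in_B_set:
  assumes "\<And>n. n \<in> B_set \<theta> \<Longrightarrow> \<theta> n = \<infinity>" and m: "m \<ge> 1"
  shows "m \<in> B_set \<theta>"
proof (rule ccontr)
  assume "m \<notin> B_set \<theta>"
  then obtain n r where nr: "n \<in> B_set \<theta>" "r \<ge> 2" "rough (\<theta> n) r"
    using B_set_decompose[OF m] by blast
  obtain p where "prime p" "p dvd r" using prime_factor_nat[of r] nr by auto
  hence "\<theta> n < ereal (real p)" using nr by (auto simp: rough_def)
  thus False using assms(1)[OF nr(1)] by simp
qed

lemma L_eq_0_iff: "L = 0 \<longleftrightarrow> (\<forall>n\<ge>1. \<theta> n = \<infinity>)"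
proof
  assume "L = 0"
  hence zero: "L_term k = 0" for k
    using suminf_eq_zero_iff[OF summable_L_term L_term_nonneg] by (simp add: L_def)
  have inf: "\<theta> n = \<infinity>" if n: "n \<in> B_set \<theta>" for n
  proof -
    have n1: "n \<ge> 1" using n by (simp add: B_set_iff)
    hence "prime_prod (\<theta> n) = 0" using zero[of "n - 1"] n by (simp add: L_term_def)
    thus ?thesis using prime_prod_pos[of "\<theta> n"] by (cases "\<theta> n = \<infinity>") auto
  qed
  thus "\<forall>n\<ge>1. \<theta> n = \<infinity>" using all_in_B_set by blast
next
  assume "\<forall>n\<ge>1. \<theta> n = \<infinity>"
  hence "L_term k = 0" for k by (simp add: L_term_def prime_prod_infinity)
  thus "L = 0" by (simp add: L_def)
qed

lemma B_count_asymp_id_iff: "(\<lambda>x. real (B_count \<theta> x)) \<sim>[at_top] (\<lambda>x. x) \<longleftrightarrow> L = 0"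
proof
  assume "(\<lambda>x. real (B_count \<theta> x)) \<sim>[at_top] (\<lambda>x. x)"
  hence "((\<lambda>x. real (B_count \<theta> x) / x) \<longlongrightarrow> 1) at_top"
    by (rule asymp_equivD_strong) (use eventually_gt_at_top[of 0] in eventually_elim, simp)
  hence "1 - L = 1" using tendsto_unique[OF _ B_count_div_tendsto] by simp
  thus "L = 0" by simp
next
  assume "L = 0"
  thus "(\<lambda>x. real (B_count \<theta> x)) \<sim>[at_top] (\<lambda>x. x)"
    using B_count_div_tendsto by (intro asymp_equivI') simp
qed

text \<open>The backward direction goes through the density: an exact count gives density 1, hence L
  = 0.\<close>

lemma theta_infinity_iff_B_count:
  "(\<forall>n\<ge>1. \<theta> n = \<infinity>) \<longleftrightarrow> (\<forall>x\<ge>0. int (B_count \<theta> x) = \<lfloor>x\<rfloor>)"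
proof
  assume inf: "\<forall>n\<ge>1. \<theta> n = \<infinity>"
  hence all: "m \<in> B_set \<theta>" if "m \<ge> 1" for m using that by (intro all_in_B_set) (auto simp: B_set_iff)
  show "\<forall>x\<ge>0. int (B_count \<theta> x) = \<lfloor>x\<rfloor>"
  proof (intro allI impI)
    fix x :: real assume x: "x \<ge> 0"
    have "{n \<in> B_set \<theta>. real n \<le> x} = {1..nat \<lfloor>x\<rfloor>}"
      using all x by (auto simp: B_set_iff le_nat_iff le_floor_iff)
    thus "int (B_count \<theta> x) = \<lfloor>x\<rfloor>" using x by (simp add: B_count_def)
  qed
next
  assume count: "\<forall>x\<ge>0. int (B_count \<theta> x) = \<lfloor>x\<rfloor>"
  have "((\<lambda>x. real (B_count \<theta> x) / x) \<longlongrightarrow> 1) at_top"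
  proof (rule Lim_transform_eventually[OF nat_floor_div_tendsto])
    show "\<forall>\<^sub>F x in at_top. real (nat \<lfloor>x\<rfloor>) / x = real (B_count \<theta> x) / x"
      using eventually_ge_at_top[of 0]
    proof eventually_elim
      case (elim x)
      hence "nat \<lfloor>x\<rfloor> = B_count \<theta> x" using count by (metis nat_int)
      thus ?case by simp
    qed
  qed
  hence "1 - L = 1" using tendsto_unique[OF _ B_count_div_tendsto] by simp
  thus "\<forall>n\<ge>1. \<theta> n = \<infinity>" using L_eq_0_iff by simp
qed

lemma L_eq_1_if_divergent:
  assumes le: "\<And>n. n \<ge> 1 \<Longrightarrow> \<theta> n \<le> ereal (f n)"
    and mono: "mono_on {1..} (\<lambda>n. real n * ln (f n))"
    and div: "\<not> summable (\<lambda>n. 1 / (real (Suc n) * ln (f (Suc n))))"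
  shows "L = 1"
proof (rule ccontr)
  assume "L \<noteq> 1"
  hence L: "L < 1" using L_bounds by simp
  define a where "a = (\<lambda>n. 1 / (real n * ln (f n)))"
  \<comment> \<open>Strictly below the density 1 - L, so the counting function eventually exceeds
    \<delta> N.\<close>
  define \<delta> where "\<delta> = (1 - L) / 2"
  have f: "f n \<ge> 2" if "n \<ge> 1" for n
    using order.trans[OF theta_ge_2[OF that] le[OF that]] by simp
  have pos: "real n * ln (f n) > 0" if "n \<ge> 1" for n using f[OF that] that by simp
  have \<delta>: "\<delta> > 0" "\<delta> < 1 - L" using L by (auto simp: \<delta>_def field_simps)
  have "\<forall>\<^sub>F x in at_top. \<delta> < real (B_count \<theta> x) / x"
    using B_count_div_tendsto \<delta>(2) by (rule order_tendstoD)
  then obtain X where X: "\<And>x. x \<ge> X \<Longrightarrow> \<delta> < real (B_count \<theta> x) / x"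
    by (auto simp: eventually_at_top_linorder)
  define N0 where "N0 = max 1 (nat \<lceil>X\<rceil>)"
  have "summable (\<lambda>k. a (Suc k))"
  proof (rule summable_if_bounded_on_dense)
    show "\<delta> > 0" by fact
    show "N0 \<ge> 1" by (simp add: N0_def)
    show "\<delta> * real N \<le> real (card (B_set \<theta> \<inter> {1..N}))" if "N \<ge> N0" for N
    proof -
      have N: "N \<ge> 1" "real N \<ge> X" using that by (auto simp: N0_def)
      have "{n \<in> B_set \<theta>. real n \<le> real N} = B_set \<theta> \<inter> {1..N}" by (auto simp: B_set_iff)
      hence "B_count \<theta> (real N) = card (B_set \<theta> \<inter> {1..N})" by (simp add: B_count_def)
      thus ?thesis using X[OF N(2)] N by (simp add: field_simps)
    qed
    show "a n \<ge> 0" if "n \<ge> 1" for n using pos[OF that] by (simp add: a_def)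
    show "a (Suc n) \<le> a n" if "n \<ge> 1" for n
    proof -
      have "real n * ln (f n) \<le> real (Suc n) * ln (f (Suc n))"
        using mono_onD[OF mono, of n "Suc n"] that by simp
      thus ?thesis unfolding a_def using pos[OF that] by (intro divide_left_mono) auto
    qed
    \<comment> \<open>On the set, Mertens' lower bound and \<open>\<theta> n\<close> \<le>
      \<open>f n\<close> bound each term by a constant times the corresponding term of L, and the
      partial sums of L are at most 1.\<close>
    show "(\<Sum>n=1..N. indicator (B_set \<theta>) n * a n) \<le> 3 * exp 4" for N
    proof -
      have "(\<Sum>n=1..N. indicator (B_set \<theta>) n * a n) = (\<Sum>k<N. indicator (B_set \<theta>) (Suc k) * a (Suc k))"
        by (simp add: sum.atLeast1_atMost_eq)
      also have "\<dots> \<le> (\<Sum>k<N. 3 * exp 4 * L_term k)"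
      proof (rule sum_mono)
        fix k
        define n where "n = Suc k"
        have n: "n \<ge> 1" by (simp add: n_def)
        have "1 / (3 * exp 4 * ln (f n)) \<le> prime_prod (ereal (f n))" using f[OF n] by (rule prime_prod_ge)
        also have "\<dots> \<le> prime_prod (\<theta> n)" using le[OF n] by (rule prime_prod_antimono) simp
        finally have "1 / ln (f n) \<le> 3 * exp 4 * prime_prod (\<theta> n)" using f[OF n] by (simp add: field_simps)
        hence "(1 / ln (f n)) * (1 / real n) \<le> 3 * exp 4 * prime_prod (\<theta> n) * (1 / real n)"
          by (rule mult_right_mono) simp
        hence "a n \<le> 3 * exp 4 * (prime_prod (\<theta> n) / real n)" by (simp add: a_def mult_ac)
        hence "indicator (B_set \<theta>) n * a n \<le> indicator (B_set \<theta>) n * (3 * exp 4 * (prime_prod (\<theta> n) / real n))"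
          by (rule mult_left_mono) simp
        thus "indicator (B_set \<theta>) (Suc k) * a (Suc k) \<le> 3 * exp 4 * L_term k"
          by (simp add: L_term_def n_def mult_ac)
      qed
      also have "\<dots> = 3 * exp 4 * (\<Sum>k<N. L_term k)" by (simp add: sum_distrib_left)
      also have "\<dots> \<le> 3 * exp 4 * 1" using sum_L_term_le_1 by (intro mult_left_mono) auto
      finally show ?thesis by simp
    qed
  qed
  thus False using div by (simp add: a_def)
qed

lemma L_less_1_if_convergent:
  assumes ge: "\<And>n. n \<ge> 1 \<Longrightarrow> \<theta> n \<ge> ereal (f n)" and f2: "\<And>n. n \<ge> 1 \<Longrightarrow> f n \<ge> 2"
    and grow: "\<And>t::real. t \<ge> 1 \<Longrightarrow> \<exists>r::nat. \<forall>n\<ge>1. f (2 ^ r * n) \<ge> t * f n"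
    and conv: "summable (\<lambda>n. 1 / (real (Suc n) * ln (f (Suc n))))"
  shows "L < 1"
proof (rule ccontr)
  assume "\<not> L < 1"
  hence L: "L = 1" using L_bounds by simp
  define c :: real where "c = 15 * exp 4"
  define w where "w = (\<lambda>k t. 1 / (real (Suc k) * ln (t * f (Suc k))))"
  have f2': "f (Suc k) \<ge> 2" for k using f2 by simp
  have w_bounds: "0 \<le> w k t \<and> w k t \<le> 1 / (real (Suc k) * ln (f (Suc k)))" if t: "t \<ge> 1" for k t
  proof -
    have ft: "f (Suc k) \<le> t * f (Suc k)" using t f2'[of k] by simp
    have "ln (f (Suc k)) > 0" using f2'[of k] by simp
    moreover have "ln (f (Suc k)) \<le> ln (t * f (Suc k))" using ft f2'[of k] by simp
    ultimately show ?thesis unfolding w_def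
      by (intro conjI divide_left_mono mult_left_mono mult_pos_pos) auto
  qed
  have summ_w: "summable (\<lambda>k. w k t)" if "t \<ge> 1" for t
    using w_bounds[OF that] by (intro summable_comparison_test'[OF conv, of 0]) auto
  \<comment> \<open>Each \<open>w k t\<close> tends to 0 as t grows and is dominated by its
    convergent t = 1 series, so the whole sum tends to 0.\<close>
  have "((\<lambda>t. \<Sum>k. w k t) \<longlongrightarrow> (\<Sum>k::nat. 0)) at_top"
  proof (rule conjunct2[OF conjunct2[OF tannerys_theorem]])
    show "((\<lambda>t. w k t) \<longlongrightarrow> 0) at_top" for k
    proof -
      have "filterlim (\<lambda>t. f (Suc k) * t) at_top at_top"
        using f2'[of k] by (intro filterlim_tendsto_pos_mult_at_top[OF tendsto_const] filterlim_ident) simp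
      hence "filterlim (\<lambda>t. real (Suc k) * ln (t * f (Suc k))) at_top at_top"
        by (intro filterlim_tendsto_pos_mult_at_top[OF tendsto_const] filterlim_compose[OF ln_at_top])
           (simp_all add: mult.commute)
      thus ?thesis unfolding w_def
        by (intro tendsto_divide_0[OF tendsto_const] filterlim_at_top_imp_at_infinity)
    qed
    show "\<forall>\<^sub>F (k, t) in sequentially \<times>\<^sub>F at_top. norm (w k t) \<le> 1 / (real (Suc k) * ln (f (Suc k)))"
      unfolding eventually_prod_filter
      by (intro exI[of _ "\<lambda>_. True"] exI[of _ "\<lambda>x. x \<ge> 1"])
        (use w_bounds in \<open>auto simp: eventually_ge_at_top simp del: of_nat_Suc\<close>)
  qed (use conv in auto)
  hence "\<forall>\<^sub>F t in at_top. (\<Sum>k. w k t) < 1 / (2 * c)"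
    by (rule order_tendstoD) (simp add: c_def)
  hence "\<forall>\<^sub>F t in at_top. t \<ge> 1 \<and> (\<Sum>k. w k t) < 1 / (2 * c)"
    using eventually_ge_at_top[of "1::real"] by eventually_elim auto
  then obtain t where t: "t \<ge> 1" "(\<Sum>k. w k t) < 1 / (2 * c)"
    by (auto simp: eventually_at_top_linorder)
  obtain R where R: "\<And>n. n \<ge> 1 \<Longrightarrow> f (2 ^ R * n) \<ge> t * f n" using grow[OF t(1)] by blast
  \<comment> \<open>The sieve constant \<open>c\<close> times the sum of \<open>w k t\<close> is
    below 1/2, so at most half of all m fail. Each failing m is n * r, where 2^R n is the first
    factor of 2^R m; the growth of \<open>f\<close> gives \<open>\<theta>\<close>(2^R n) \<ge> t
    f(n), so r is rough at that level.\<close>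
  have few: "real (card {m. 1 \<le> m \<and> real m \<le> x \<and> 2 ^ R * m \<notin> B_set \<theta>}) \<le> x / 2" if x: "x \<ge> 0" for x
  proof -
    define N where "N = nat \<lfloor>x\<rfloor>"
    have le: "real r \<le> x \<longleftrightarrow> r \<le> N" for r using x by (auto simp: N_def le_nat_iff le_floor_iff)
    define Q where "Q = (\<lambda>n. {r. 2 \<le> r \<and> real r \<le> x / real n \<and> rough (ereal (t * f n)) r})"
    have finQ: "finite (Q n)" for n
      unfolding Q_def by (rule finite_subset[OF _ finite_nat_real_le[of "\<lambda>_. True" "x / real n"]]) auto
    have "{m. 1 \<le> m \<and> real m \<le> x \<and> 2 ^ R * m \<notin> B_set \<theta>} \<subseteq> (\<Union>n\<in>{1..N}. (\<lambda>r. n * r) ` Q n)"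
    proof
      fix m assume "m \<in> {m. 1 \<le> m \<and> real m \<le> x \<and> 2 ^ R * m \<notin> B_set \<theta>}"
      hence m: "1 \<le> m" "real m \<le> x" "2 ^ R * m \<notin> B_set \<theta>" by auto
      have "2 ^ R * m \<ge> 1" using m by simp
      then obtain n' r where nr: "2 ^ R * m = n' * r" "n' \<in> B_set \<theta>" "r \<ge> 2" "rough (\<theta> n') r"
        using B_set_decompose m(3) by blast
      \<comment> \<open>\<open>\<theta> \<ge> 2\<close> makes \<open>r\<close> odd, so the whole factor \<open>2 ^ R\<close> divides \<open>n'\<close>.\<close>
      have "\<theta> n' \<ge> 2" using nr by (intro theta_ge_2) (simp add: B_set_iff)
      hence "\<not> 2 dvd r" using nr(4) two_is_prime_nat unfolding rough_def by (metis leD numeral_eq_ereal of_nat_numeral)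
      hence "coprime (2 ^ R) r" by simp
      hence "2 ^ R dvd n'" using nr(1) by (metis coprime_dvd_mult_left_iff dvd_triv_left)
      then obtain n where n: "n' = 2 ^ R * n" by blast
      have mn: "m = n * r" using nr(1) n by simp
      have n1: "n \<ge> 1" using mn m by (cases n) auto
      have "n \<le> m" using mn nr by simp
      hence nN: "n \<in> {1..N}" using n1 m(2) unfolding le by simp
      have "ereal (t * f n) \<le> ereal (f n')" using R[OF n1] unfolding n by simp
      also have "\<dots> \<le> \<theta> n'" using nr(2) by (intro ge) (simp add: B_set_iff)
      finally have "rough (ereal (t * f n)) r" using nr(4) unfolding rough_def by (meson le_less_trans)
      hence "r \<in> Q n" using nr mn m n1 by (simp add: Q_def field_simps)
      thus "m \<in> (\<Union>n\<in>{1..N}. (\<lambda>r. n * r) ` Q n)" using nN mn by blast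
    qed
    hence "card {m. 1 \<le> m \<and> real m \<le> x \<and> 2 ^ R * m \<notin> B_set \<theta>} \<le> card (\<Union>n\<in>{1..N}. (\<lambda>r. n * r) ` Q n)"
      using finQ by (intro card_mono) auto
    also have "\<dots> \<le> (\<Sum>n\<in>{1..N}. card ((\<lambda>r. n * r) ` Q n))" by (rule card_UN_le) simp
    also have "\<dots> \<le> (\<Sum>n\<in>{1..N}. card (Q n))" by (intro sum_mono card_image_le finQ)
    finally have "real (card {m. 1 \<le> m \<and> real m \<le> x \<and> 2 ^ R * m \<notin> B_set \<theta>})
        \<le> real (\<Sum>n\<in>{1..N}. card (Q n))" by (simp only: of_nat_le_iff)
    also have "\<dots> = (\<Sum>k<N. real (rough_count (x / real (Suc k)) (ereal (t * f (Suc k)))))"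
      by (simp add: Q_def rough_count_def sum.atLeast1_atMost_eq del: of_nat_Suc)
    also have "\<dots> \<le> (\<Sum>k<N. c * x * w k t)"
    proof (rule sum_mono)
      fix k
      have tf: "t * f (Suc k) \<ge> 2" using t(1) f2'[of k] mult_mono[of 1 t 2 "f (Suc k)"] by simp
      have "real (rough_count (x / real (Suc k)) (ereal (t * f (Suc k))))
          \<le> 15 * exp 4 * (x / real (Suc k)) * prime_prod (ereal (t * f (Suc k)))"
        using x by (intro rough_count_le) simp
      also have "\<dots> \<le> 15 * exp 4 * (x / real (Suc k)) * (1 / ln (t * f (Suc k)))"
        using x tf by (intro mult_left_mono prime_prod_le_inverse_ln) auto
      also have "\<dots> = c * x * w k t" by (simp add: c_def w_def)
      finally show "real (rough_count (x / real (Suc k)) (ereal (t * f (Suc k)))) \<le> c * x * w k t" .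
    qed
    also have "\<dots> = c * x * (\<Sum>k<N. w k t)" by (simp add: sum_distrib_left)
    also have "\<dots> \<le> c * x * (\<Sum>k. w k t)"
      using x w_bounds[OF t(1)] by (intro mult_left_mono sum_le_suminf summ_w t) (auto simp: c_def)
    also have "\<dots> \<le> c * x * (1 / (2 * c))" using x t(2) by (intro mult_left_mono) (auto simp: c_def)
    also have "\<dots> = x / 2" by (simp add: c_def)
    finally show ?thesis .
  qed
  have many: "x / 2 - 1 \<le> real (B_count \<theta> (2 ^ R * x))" if x: "x \<ge> 0" for x
  proof -
    let ?G = "{m. 1 \<le> m \<and> real m \<le> x \<and> 2 ^ R * m \<in> B_set \<theta>}"
    let ?H = "{m. 1 \<le> m \<and> real m \<le> x \<and> 2 ^ R * m \<notin> B_set \<theta>}"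
    have fin: "finite ?G" "finite ?H"
      by (rule finite_subset[OF _ finite_nat_real_le[of "\<lambda>_. True" x]], force)+
    have "{1..nat \<lfloor>x\<rfloor>} = ?G \<union> ?H" using x by (auto simp: le_nat_iff le_floor_iff)
    hence "nat \<lfloor>x\<rfloor> = card (?G \<union> ?H)" by (metis card_atLeastAtMost diff_Suc_1)
    also have "\<dots> \<le> card ?G + card ?H" by (rule card_Un_le)
    finally have "real (nat \<lfloor>x\<rfloor>) \<le> real (card ?G) + x / 2" using few[OF x] by linarith
    moreover have "x - 1 \<le> real (nat \<lfloor>x\<rfloor>)" using x by linarith
    moreover have "card ?G \<le> B_count \<theta> (2 ^ R * x)"
    proof -
      have "card ?G = card ((\<lambda>m. 2 ^ R * m) ` ?G)" by (rule card_image[symmetric]) (auto simp: inj_on_def)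
      also have "\<dots> \<le> B_count \<theta> (2 ^ R * x)"
        unfolding B_count_def by (rule card_mono[OF finite_nat_real_le]) auto
      finally show ?thesis .
    qed
    ultimately show ?thesis by linarith
  qed
  \<comment> \<open>L = 1 means density 0. At y = 2^R x this threshold leaves fewer than x/4
    elements, whereas \<open>many\<close> provides x/2 - 1, which is at least x/4 once x \<ge>
    4.\<close>
  have "\<forall>\<^sub>F y in at_top. real (B_count \<theta> y) / y < 1 / (4 * 2 ^ R)"
    using order_tendstoD(2)[OF B_count_div_tendsto, of "1 / (4 * 2 ^ R)"] L by simp
  then obtain Y where Y: "\<And>y. y \<ge> Y \<Longrightarrow> real (B_count \<theta> y) / y < 1 / (4 * 2 ^ R)"
    by (auto simp: eventually_at_top_linorder)
  define x where "x = max Y 4"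
  have x: "x \<ge> 4" "x \<ge> Y" by (auto simp: x_def)
  have "x \<le> 2 ^ R * x" using x by simp
  hence "2 ^ R * x \<ge> Y" using x by linarith
  hence "real (B_count \<theta> (2 ^ R * x)) < x / 4" using Y[of "2 ^ R * x"] x by (simp add: field_simps)
  thus False using many[of x] x by linarith
qed

end

section \<open>Assembly of the three parts from the density 1 - L\<close>

theorem theorem2p2:
  fixes \<theta> :: "nat \<Rightarrow> ereal"
  assumes theta_1: "\<theta> 1 \<ge> 2"
    and theta_ge: "\<And>n. n \<ge> 2 \<Longrightarrow> \<theta> n \<ge> ereal (real (Pplus n))"
  shows
    "(\<forall>f :: nat \<Rightarrow> real.
        (\<forall>n\<ge>1. \<theta> n \<le> ereal (f n)) \<longrightarrow>
        mono_on {1..} (\<lambda>n. real n * ln (f n)) \<longrightarrow>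
        \<not> summable (\<lambda>n. 1 / (real (Suc n) * ln (f (Suc n)))) \<longrightarrow>
        L_const \<theta> = 1 \<and> (\<lambda>x. real (B_count \<theta> x)) \<in> o[at_top](\<lambda>x. x))
     \<and>
     (\<forall>f :: nat \<Rightarrow> real.
        (\<forall>n\<ge>1. \<theta> n \<ge> ereal (f n) \<and> f n \<ge> 2) \<longrightarrow>
        (\<exists>c>0. \<forall>n\<ge>1. f n \<ge> c * real (Pplus n)) \<longrightarrow>
        (\<forall>t::real. t \<ge> 1 \<longrightarrow> (\<exists>r::nat. \<forall>n\<ge>1. f (2 ^ r * n) \<ge> t * f n)) \<longrightarrow>
        summable (\<lambda>n. 1 / (real (Suc n) * ln (f (Suc n)))) \<longrightarrow>
        L_const \<theta> < 1 \<and>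
        (\<lambda>x. real (B_count \<theta> x)) \<sim>[at_top] (\<lambda>x. (1 - enn2real (L_const \<theta>)) * x))
     \<and>
     (((\<lambda>x. real (B_count \<theta> x)) \<sim>[at_top] (\<lambda>x. x)) \<longleftrightarrow> L_const \<theta> = 0)
     \<and> (L_const \<theta> = 0 \<longleftrightarrow> (\<forall>n\<ge>1. \<theta> n = \<infinity>))
     \<and> ((\<forall>n\<ge>1. \<theta> n = \<infinity>) \<longleftrightarrow> (\<forall>x\<ge>0. int (B_count \<theta> x) = \<lfloor>x\<rfloor>))"
proof -
  interpret prime_bound \<theta> by standard (use assms in auto)
  have L0: "L_const \<theta> = 0 \<longleftrightarrow> L = 0" using L_const_eq L_bounds by simp
  show ?thesis
  proof (intro conjI allI impI)
    fix f :: "nat \<Rightarrow> real"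
    assume le: "\<forall>n\<ge>1. \<theta> n \<le> ereal (f n)"
      and mono: "mono_on {1..} (\<lambda>n. real n * ln (f n))"
      and div: "\<not> summable (\<lambda>n. 1 / (real (Suc n) * ln (f (Suc n))))"
    have L: "L = 1" using L_eq_1_if_divergent[OF _ mono div] le by blast
    thus "L_const \<theta> = 1" by (simp add: L_const_eq)
    show "(\<lambda>x. real (B_count \<theta> x)) \<in> o[at_top](\<lambda>x. x)"
    proof (rule smalloI_tendsto)
      show "((\<lambda>x. real (B_count \<theta> x) / x) \<longlongrightarrow> 0) at_top" using B_count_div_tendsto L by simp
      show "\<forall>\<^sub>F x in at_top. x \<noteq> (0::real)" using eventually_gt_at_top[of 0] by eventually_elim simp
    qed
  next
    fix f :: "nat \<Rightarrow> real"
    assume ge: "\<forall>n\<ge>1. \<theta> n \<ge> ereal (f n) \<and> f n \<ge> 2"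
      and grow: "\<forall>t::real. t \<ge> 1 \<longrightarrow> (\<exists>r::nat. \<forall>n\<ge>1. f (2 ^ r * n) \<ge> t * f n)"
      and conv: "summable (\<lambda>n. 1 / (real (Suc n) * ln (f (Suc n))))"
    have L: "L < 1" by (rule L_less_1_if_convergent[OF _ _ _ conv]) (use ge grow in auto)
    thus "L_const \<theta> < 1" using L_bounds by (simp add: L_const_eq)
    show "(\<lambda>x. real (B_count \<theta> x)) \<sim>[at_top] (\<lambda>x. (1 - enn2real (L_const \<theta>)) * x)"
    proof (rule asymp_equivI')
      have "((\<lambda>x. real (B_count \<theta> x) / x / (1 - L)) \<longlongrightarrow> (1 - L) / (1 - L)) at_top"
        using L by (intro tendsto_divide B_count_div_tendsto tendsto_const) simp
      thus "((\<lambda>x. real (B_count \<theta> x) / ((1 - enn2real (L_const \<theta>)) * x)) \<longlongrightarrow> 1) at_top"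
        using L L_bounds by (simp add: L_const_eq mult.commute)
    qed
  qed (simp_all only: L0 B_count_asymp_id_iff L_eq_0_iff theta_infinity_iff_B_count)
qed

end
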